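(* Let $q>0$ and let $\mu$ be a non-zero even finite Borel measure on $\mathbb{R}^n$. Suppose $\mu$ is not concentrated in any proper subspace and $\int_{\mathbb{R}^n}|x|\,d\mu(x)<\infty$. Then there exists an even $f_0\in\mathrm{LC}(\mathbb{R}^n)$ with nonzero finite $L^1$ norm such that $$\mu=\widetilde{C}^{e}_{q}(f_0;\cdot).$$
   Context: $\mathrm{LC}(\mathbb{R}^n)$ is the set of all upper semi-continuous log-concave functions $f:\mathbb{R}^n\to[0,\infty)$, i.e. $f=e^{-\phi}$ with $\phi:\mathbb{R}^n\to(-\infty,\infty]$ lower semi-continuous and convex. For $f=e^{-\phi}\in\mathrm{LC}(\mathbb{R}^n)$ with nonzero finite $L^1$ norm, the Euclidean $q$-th dual curvature measure of $f$ is the Borel measure on $\mathbb{R}^n$ $$\widetilde{C}^{e}_{q}(f;\mathcal{B})=\int_{\{x:\,\nabla\phi(x)\in\mathcal{B}\}}|x|^{q-n}f(x)\,dx$$ for Borel $\mathcal{B}\subset\mathbb{R}^n$ (here $\nabla\phi$ exists almost everywhere on $\{\phi<\infty\}=\{f>0\}$). A measure $\mu$ is even if $\mu(-\mathcal{B})=\mu(\mathcal{B})$ for all Borel $\mathcal{B}$; it is not concentrated in any proper subspace if $\mu(\mathbb{R}^n\setminus H)>0$ for every proper linear subspace $H\subset\mathbb{R}^n$. *)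

theory Defs
  imports "HOL-Analysis.Analysis"
begin

definition lower_semicontinuous :: "('a::topological_space \<Rightarrow> ereal) \<Rightarrow> bool" where
  "lower_semicontinuous \<phi> \<longleftrightarrow> (\<forall>x. \<phi> x \<le> Liminf (at x) \<phi>)"

(* Only meaningful for functions omitting the value -\<infinity>, so that no \<infinity> - \<infinity> arises on the right. *)
definition ereal_convex :: "('a::real_vector \<Rightarrow> ereal) \<Rightarrow> bool" where
  "ereal_convex \<phi> \<longleftrightarrow>
     (\<forall>x y t. 0 < t \<and> t < 1 \<longrightarrow>
        \<phi> ((1 - t) *\<^sub>R x + t *\<^sub>R y) \<le> ereal (1 - t) * \<phi> x + ereal t * \<phi> y)"

(* exp (-r), with exp (-\<infinity>) = 0; the value at r = -\<infinity> is irrelevant. *)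
definition exp_minus :: "ereal \<Rightarrow> real" where
  "exp_minus r = (if r = \<infinity> then 0 else exp (- real_of_ereal r))"

definition LC :: "('a::euclidean_space \<Rightarrow> real) set" where
  "LC = {f. \<exists>\<phi>. (\<forall>x. \<phi> x \<noteq> -\<infinity>) \<and> lower_semicontinuous \<phi> \<and> ereal_convex \<phi> \<and>
              (\<forall>x. f x = exp_minus (\<phi> x))}"

(* The potential \<phi> with f = exp (-\<phi>); it is determined by f, see potential_exp_minus. *)
definition potential :: "('a \<Rightarrow> real) \<Rightarrow> 'a \<Rightarrow> ereal" where
  "potential f x = (if f x = 0 then \<infinity> else ereal (- ln (f x)))"

lemma potential_exp_minus:
  assumes "\<And>x. \<phi> x \<noteq> -\<infinity>" and "\<And>x. f x = exp_minus (\<phi> x)"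
  shows "potential f = \<phi>"
proof
  fix x
  show "potential f x = \<phi> x"
    using assms[of x] by (cases "\<phi> x") (auto simp: potential_def exp_minus_def)
qed

(* An extended-real-valued function has a gradient at x only if it is finite near x. *)
definition has_gradient :: "('a::euclidean_space \<Rightarrow> ereal) \<Rightarrow> 'a \<Rightarrow> 'a \<Rightarrow> bool" where
  "has_gradient \<phi> x v \<longleftrightarrow>
     x \<in> interior {y. \<bar>\<phi> y\<bar> \<noteq> \<infinity>} \<and> (GDERIV (\<lambda>y. real_of_ereal (\<phi> y)) x :> v)"

(* The value of the weight at the origin (0 powr _ = 0) is immaterial: it is a null set. *)
definition dual_curvature :: "real \<Rightarrow> ('a::euclidean_space \<Rightarrow> real) \<Rightarrow> 'a set \<Rightarrow> ennreal" where
  "dual_curvature q f B =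
     (\<integral>\<^sup>+ x \<in> {x. \<exists>v\<in>B. has_gradient (potential f) x v}.
        ennreal (norm x powr (q - real DIM('a)) * f x) \<partial>lborel)"

definition even_measure :: "'a::real_normed_vector measure \<Rightarrow> bool" where
  "even_measure \<mu> \<longleftrightarrow> (\<forall>B\<in>sets borel. emeasure \<mu> (uminus ` B) = emeasure \<mu> B)"

definition not_concentrated_in_proper_subspace :: "'a::euclidean_space measure \<Rightarrow> bool" where
  "not_concentrated_in_proper_subspace \<mu> \<longleftrightarrow>
     (\<forall>H. subspace H \<and> H \<noteq> UNIV \<longrightarrow> emeasure \<mu> (UNIV - H) > 0)"

end

(* Only functions psi that are even and 1-Lipschitz are considered, which confines everything to the
   unit ball: E psi = exp (- psi^* ) vanishes outside it.  Let Z psi be the integral of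
   |x|^(q-n) E psi x.  The functional Z psi * exp (- mean of psi under mu) is invariant under adding
   constants, bounded, and upper semicontinuous under pointwise convergence, and the 1-Lipschitz
   functions vanishing at 0 are sequentially compact; so it attains its maximum at some psi.

   At almost every x of the domain of psi^* the infimum of psi y - <x, y> is attained at exactly one
   point T x, and then T x is the gradient of psi^* at x and
   d/dt (psi + t eta)^* x = - eta (T x) at t = 0+.  For bounded even eta the perturbation psi + t eta
   can be replaced by its largest 1-Lipschitz minorant, which only increases the functional; so
   maximality yields that T pushes |x|^(q-n) E psi forward to a multiple of mu.  Neither convexity
   of psi nor essential continuity of the potential is needed, since a jump of the density at the
   boundary of its support is allowed. *)

theory Submission
  imports Defs "HOL-Complex_Analysis.Great_Picard"
begin

section \<open>Exponentials of Legendre transforms\<close>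

text \<open>Exponentiating minus the conjugate gives a real number everywhere: it is 0 outside the
  domain, and as an infimum of continuous functions of x it is Borel. The shape of the functional
  comes from its critical points. The logarithmic derivative of Z at \<psi> in direction \<eta> is
  the mean of \<eta> o T under the normalised density, and the exponential factor subtracts the mean
  of \<eta> under the normalised \<mu>. Criticality thus equates two probability measures on even
  test functions. The total mass is adjusted at the end by scaling f, which scales the curvature
  measure and leaves the gradient alone. The obstacle is that the Lipschitz condition which provides
  compactness would normally turn criticality into a mere variational inequality; passing to
  minorants shows that this constraint is never active. One-sided derivatives are enough, since
  \<eta> and -\<eta> are both allowed. Almost everywhere uniqueness of the minimiser is obtained
  from monotonicity: two minimisers are separated by a slab with rational bounds in a coordinate
  direction, and each such slab contributes a null set by Fubini along lines.\<close>

definition expconj :: "'a::euclidean_space set \<Rightarrow> ('a \<Rightarrow> real) \<Rightarrow> 'a \<Rightarrow> real" where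
  "expconj C \<psi> x = (INF y\<in>C. exp (\<psi> y - x \<bullet> y))"

lemma bdd_below_expconj: "bdd_below ((\<lambda>y. exp (\<psi> y - x \<bullet> y)) ` C)"
  for \<psi> :: "'a::euclidean_space \<Rightarrow> real"
  by (rule bdd_belowI[of _ 0]) auto

lemma expconj_le: "y \<in> C \<Longrightarrow> expconj C \<psi> x \<le> exp (\<psi> y - x \<bullet> y)"
  unfolding expconj_def by (rule cINF_lower[OF bdd_below_expconj])

lemma expconj_greatest:
  assumes "C \<noteq> {}" and "\<And>y. y \<in> C \<Longrightarrow> c \<le> exp (\<psi> y - x \<bullet> y)"
  shows "c \<le> expconj C \<psi> x"
  unfolding expconj_def using assms by (rule cINF_greatest)

lemma expconj_nonneg: "C \<noteq> {} \<Longrightarrow> 0 \<le> expconj C \<psi> x"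
  by (rule expconj_greatest) auto

lemma expconj_less_iff:
  assumes "C \<noteq> {}"
  shows "expconj C \<psi> x < c \<longleftrightarrow> (\<exists>y\<in>C. exp (\<psi> y - x \<bullet> y) < c)"
  unfolding expconj_def using cINF_less_iff[OF assms bdd_below_expconj] .

text \<open>A strict sublevel set is a union of open sets indexed by \<open>C\<close>. The union may
  be uncountable and is still open, so \<open>expconj C \<psi>\<close> is upper semicontinuous for
  every \<open>\<psi>\<close>.\<close>

lemma borel_measurable_expconj:
  assumes "C \<noteq> {}"
  shows "expconj C \<psi> \<in> borel_measurable borel"
proof (rule borel_measurableI_less)
  fix c
  have "open {x. exp (\<psi> y - x \<bullet> y) < c}" for y
    by (intro open_Collect_less continuous_intros)
  then have "open (\<Union>y\<in>C. {x. exp (\<psi> y - x \<bullet> y) < c})"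
    by blast
  also have "(\<Union>y\<in>C. {x. exp (\<psi> y - x \<bullet> y) < c}) = {x. expconj C \<psi> x < c}"
    using expconj_less_iff[OF assms] by blast
  finally show "{x \<in> space borel. expconj C \<psi> x < c} \<in> sets borel"
    by simp
qed

lemma expconj_uminus:
  assumes "\<And>y. \<psi> (- y) = \<psi> y"
  shows "expconj UNIV \<psi> (- x) = expconj UNIV \<psi> x"
proof -
  have le: "expconj UNIV \<psi> x \<le> expconj UNIV \<psi> (- x)" for x
  proof (rule expconj_greatest)
    fix y show "expconj UNIV \<psi> x \<le> exp (\<psi> y - (- x) \<bullet> y)"
      using expconj_le[of "- y" UNIV \<psi> x] assms[of y] by simp
  qed simp
  show ?thesis using le[of x] le[of "- x"] by simp
qed

text \<open>The case \<open>m = 0\<close> is monotonicity in \<open>\<psi>\<close>. Exchanging the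
  roles of the two functions gives the reverse comparison, which is how two-sided bounds are
  obtained below.\<close>

lemma expconj_perturb_le:
  assumes "\<And>y. \<psi>' y \<le> \<psi> y + m"
  shows "expconj UNIV \<psi>' x \<le> exp m * expconj UNIV \<psi> x"
proof -
  have "exp (- m) * expconj UNIV \<psi>' x \<le> expconj UNIV \<psi> x"
  proof (rule expconj_greatest)
    fix y :: 'a
    have "expconj UNIV \<psi>' x \<le> exp (\<psi>' y - x \<bullet> y)" by (rule expconj_le) simp
    also have "\<dots> \<le> exp (m + (\<psi> y - x \<bullet> y))" using assms[of y] by simp
    finally have "expconj UNIV \<psi>' x \<le> exp m * exp (\<psi> y - x \<bullet> y)" by (simp add: exp_add)
    then show "exp (- m) * expconj UNIV \<psi>' x \<le> exp (\<psi> y - x \<bullet> y)"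
      by (simp add: exp_minus field_simps)
  qed simp
  then show ?thesis by (simp add: exp_minus field_simps)
qed

lemma expconj_eq_0:
  assumes lip: "\<And>x y. \<bar>\<psi> x - \<psi> y\<bar> \<le> norm (x - y)" and x: "norm x > 1"
  shows "expconj UNIV \<psi> x = 0"
proof (rule antisym)
  \<comment> \<open>Along the ray \<open>y = n x\<close> the Lipschitz bound lets
    \<open>\<psi>\<close> grow by at most \<open>n * norm x\<close>, while the linear term removes
    \<open>n * (norm x)^2\<close>; \<open>?a\<close> is the net loss per step, positive exactly
    because \<open>norm x > 1\<close>.\<close>
  let ?a = "norm x * (norm x - 1)"
  have a: "?a > 0" using x by (intro mult_pos_pos) auto
  have bound: "expconj UNIV \<psi> x \<le> exp (\<psi> 0 - real n * ?a)" for n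
  proof -
    have "\<psi> (real n *\<^sub>R x) \<le> \<psi> 0 + real n * norm x"
      using lip[of "real n *\<^sub>R x" 0] by simp
    then have "\<psi> (real n *\<^sub>R x) - x \<bullet> (real n *\<^sub>R x) \<le> \<psi> 0 - real n * ?a"
      by (simp add: algebra_simps dot_square_norm power2_eq_square)
    then show ?thesis
      using expconj_le[of "real n *\<^sub>R x" UNIV \<psi> x] by (meson UNIV_I exp_le_cancel_iff order_trans)
  qed
  have "(\<lambda>n. exp (\<psi> 0 - real n * ?a)) \<longlonglongrightarrow> 0"
  proof -
    have "(\<lambda>n. exp (\<psi> 0) * exp (- ?a) ^ n) \<longlonglongrightarrow> exp (\<psi> 0) * 0"
      by (intro tendsto_mult tendsto_const LIMSEQ_realpow_zero) (use a in auto)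
    moreover have "exp (\<psi> 0 - real n * ?a) = exp (\<psi> 0) * exp (- ?a) ^ n" for n
      by (simp add: exp_of_nat_mult[symmetric] exp_add[symmetric] del: mult_minus_right)
    ultimately show ?thesis by simp
  qed
  then show "expconj UNIV \<psi> x \<le> 0"
    by (rule tendsto_lowerbound) (use bound in auto)
qed (rule expconj_nonneg, simp)

text \<open>This identifies the positivity set with the domain of the conjugate: the slopes of the
  affine minorants of \<open>\<psi>\<close>. Convexity and coercivity are read off from such
  minorants.\<close>

lemma expconj_pos_iff:
  "expconj UNIV \<psi> x > 0 \<longleftrightarrow> (\<exists>c. \<forall>y. c \<le> \<psi> y - x \<bullet> y)"
proof
  assume pos: "expconj UNIV \<psi> x > 0"
  have "ln (expconj UNIV \<psi> x) \<le> \<psi> y - x \<bullet> y" for y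
    using expconj_le[of y UNIV \<psi> x] pos by (metis UNIV_I ln_exp ln_le_cancel_iff exp_gt_zero)
  then show "\<exists>c. \<forall>y. c \<le> \<psi> y - x \<bullet> y" by blast
next
  assume "\<exists>c. \<forall>y. c \<le> \<psi> y - x \<bullet> y"
  then obtain c where "\<forall>y. c \<le> \<psi> y - x \<bullet> y" by blast
  then have "exp c \<le> expconj UNIV \<psi> x"
    by (intro expconj_greatest) auto
  then show "expconj UNIV \<psi> x > 0"
    using exp_gt_zero less_le_trans by blast
qed

section \<open>Convexity of the domain and coercivity at its interior points\<close>

lemma convex_expconj_pos: "convex {x. expconj UNIV \<psi> x > 0}"
proof (rule convexI)
  fix x y :: 'a and u v :: real
  assume "x \<in> {x. expconj UNIV \<psi> x > 0}" "y \<in> {x. expconj UNIV \<psi> x > 0}"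
    and uv: "0 \<le> u" "0 \<le> v" "u + v = 1"
  then obtain c d where cd: "\<And>z. c \<le> \<psi> z - x \<bullet> z" "\<And>z. d \<le> \<psi> z - y \<bullet> z"
    by (auto simp: expconj_pos_iff)
  have "u * c + v * d \<le> \<psi> z - (u *\<^sub>R x + v *\<^sub>R y) \<bullet> z" for z
  proof -
    have "u * c + v * d \<le> u * (\<psi> z - x \<bullet> z) + v * (\<psi> z - y \<bullet> z)"
      using cd uv by (intro add_mono mult_left_mono) auto
    also have "\<dots> = (u + v) * \<psi> z - (u *\<^sub>R x + v *\<^sub>R y) \<bullet> z"
      by (simp add: algebra_simps)
    finally show ?thesis using uv by simp
  qed
  then show "u *\<^sub>R x + v *\<^sub>R y \<in> {x. expconj UNIV \<psi> x > 0}"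
    by (auto simp: expconj_pos_iff)
qed

text \<open>The frontier of a convex set is Lebesgue null, so boundary points of the domain can be
  discarded even though the function may jump there.\<close>

lemma AE_expconj_pos_interior:
  "AE x in lborel. expconj UNIV \<psi> x > 0 \<longrightarrow> x \<in> interior {x. expconj UNIV \<psi> x > 0}"
proof (rule AE_I')
  let ?D = "{x. expconj UNIV \<psi> x > 0}"
  have "negligible (frontier ?D)"
    by (rule negligible_convex_frontier[OF convex_expconj_pos])
  then have "frontier ?D \<in> null_sets lebesgue"
    by (simp add: negligible_iff_null_sets)
  then show "frontier ?D \<in> null_sets lborel"
    by (simp add: null_sets_completion_iff)
  show "{x \<in> space lborel. \<not> (expconj UNIV \<psi> x > 0 \<longrightarrow> x \<in> interior ?D)} \<subseteq> frontier ?D"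
    using closure_subset[of ?D] by (auto simp: frontier_def)
qed

lemma coercive_attains_inf:
  fixes g :: "'a::euclidean_space \<Rightarrow> real"
  assumes "continuous_on UNIV g" and r: "r > 0" and g: "\<And>y. g y \<ge> r * norm y - b"
    and C: "closed C" "C \<noteq> {}"
  obtains y where "y \<in> C" "\<And>z. z \<in> C \<Longrightarrow> g y \<le> g z"
proof -
  obtain y0 where y0: "y0 \<in> C" using C by blast
  define \<rho> where "\<rho> = (g y0 + b) / r"
  have \<rho>: "norm z \<le> \<rho>" if "g z \<le> g y0" for z
    using g[of z] that r by (simp add: \<rho>_def field_simps)
  have "compact (C \<inter> cball 0 \<rho>)"
    using C by (intro closed_Int_compact) auto
  moreover have "C \<inter> cball 0 \<rho> \<noteq> {}"
    using y0 \<rho>[of y0] by (auto simp: dist_norm)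
  moreover have "continuous_on (C \<inter> cball 0 \<rho>) g"
    using assms(1) continuous_on_subset by blast
  ultimately obtain y where y: "y \<in> C \<inter> cball 0 \<rho>" "\<forall>z\<in>C \<inter> cball 0 \<rho>. g y \<le> g z"
    using continuous_attains_inf by blast
  have "g y \<le> g z" if "z \<in> C" for z
  proof (cases "g z \<le> g y0")
    case True
    then show ?thesis using y that \<rho>[of z] by (auto simp: dist_norm)
  next
    case False
    moreover have "g y \<le> g y0" using y y0 \<rho>[of y0] by (auto simp: dist_norm)
    ultimately show ?thesis by linarith
  qed
  then show ?thesis using that y by blast
qed

text \<open>A gap proportional to the distance, and not merely a positive one, is what absorbs a
  small linear perturbation far from the minimiser. Away from \<open>y0\<close>, compactness gives a
  constant gap and coercivity gives linear growth minus a constant; a convex combination of the two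
  bounds cancels the constant.\<close>

lemma coercive_linear_gap:
  fixes g :: "'a::euclidean_space \<Rightarrow> real"
  assumes cont: "continuous_on UNIV g" and r: "r > 0" and g: "\<And>y. g y \<ge> r * norm y - b"
    and strict: "\<And>y. y \<noteq> y0 \<Longrightarrow> g y0 < g y" and \<delta>: "\<delta> > 0"
  obtains \<kappa> where "\<kappa> > 0" "\<And>y. norm (y - y0) \<ge> \<delta> \<Longrightarrow> g y \<ge> g y0 + \<kappa> * norm (y - y0)"
proof (cases "{y. \<delta> \<le> norm (y - y0)} = {}")
  case True
  then show ?thesis using that[of 1] by auto
next
  case False
  have "closed {y. \<delta> \<le> norm (y - y0)}"
    by (intro closed_Collect_le continuous_intros)
  from coercive_attains_inf[OF cont r g this False] obtain y1
    where y1: "\<delta> \<le> norm (y1 - y0)" "\<And>z. \<delta> \<le> norm (z - y0) \<Longrightarrow> g y1 \<le> g z"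
    by auto
  define k where "k = g y1 - g y0"
  have k: "k > 0" using strict[of y1] y1(1) \<delta> by (cases "y1 = y0") (auto simp: k_def)
  define m where "m = max (r * norm y0 + b + g y0) 0"
  \<comment> \<open>The weight solves \<open>(1 - l) * k = l * m\<close>, so the constant gap
    \<open>k\<close> exactly pays for the loss \<open>m\<close> in the linear bound. Truncating
    \<open>m\<close> at 0 ensures \<open>l \<le> 1\<close>.\<close>
  define l where "l = k / (k + m)"
  have m: "m \<ge> 0" by (simp add: m_def)
  have l: "0 < l" "l \<le> 1" using k m by (auto simp: l_def)
  have lm: "(1 - l) * k = l * m" using k m by (simp add: l_def field_simps)
  show ?thesis
  proof (rule that[of "l * r"])
    show "l * r > 0" using l r by simp
    fix y assume y: "\<delta> \<le> norm (y - y0)"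
    have "norm (y - y0) \<le> norm y + norm y0" by (rule norm_triangle_ineq4)
    then have "r * norm (y - y0) \<le> r * norm y + r * norm y0"
      using r by (metis distrib_left mult_le_cancel_left_pos)
    then have 1: "r * norm (y - y0) - m \<le> g y - g y0"
      using g[of y] by (auto simp: m_def)
    have 2: "k \<le> g y - g y0" using y1(2)[OF y] by (simp add: k_def)
    have "l * r * norm (y - y0) = (1 - l) * k + l * (r * norm (y - y0) - m)"
      using lm by (simp add: algebra_simps)
    also have "\<dots> \<le> (1 - l) * (g y - g y0) + l * (g y - g y0)"
      using 1 2 l by (intro add_mono mult_left_mono) auto
    finally show "g y0 + l * r * norm (y - y0) \<le> g y" by (simp add: algebra_simps)
  qed
qed

text \<open>Near an interior point \<open>x\<close> the slopes \<open>x + e b\<close> and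
  \<open>x - e b\<close> also belong to the domain for each basis vector \<open>b\<close>. The two
  affine minorants give growth \<open>e * \<bar>y \<bullet> b\<bar>\<close>; averaging over the
  basis and comparing the l1 norm with the Euclidean one yields the rate
  \<open>e / DIM('a)\<close>.\<close>

lemma expconj_coercive:
  fixes \<psi> :: "'a::euclidean_space \<Rightarrow> real"
  assumes "x \<in> interior {x. expconj UNIV \<psi> x > 0}"
  obtains r b where "r > 0" "\<And>y. \<psi> y - x \<bullet> y \<ge> r * norm y - b"
proof -
  let ?D = "{x. expconj UNIV \<psi> x > 0}"
  obtain e where e: "e > 0" "cball x e \<subseteq> ?D"
    using assms by (meson mem_interior_cball)
  have "\<exists>c. \<forall>y. c + e * \<bar>y \<bullet> b\<bar> \<le> \<psi> y - x \<bullet> y" if b: "b \<in> Basis" for b :: 'a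
  proof -
    have "x + e *\<^sub>R b \<in> ?D" "x - e *\<^sub>R b \<in> ?D"
      by (rule subsetD[OF e(2)], use e b in \<open>simp add: dist_norm\<close>)+
    then obtain c d where "\<And>y. c \<le> \<psi> y - (x + e *\<^sub>R b) \<bullet> y" "\<And>y. d \<le> \<psi> y - (x - e *\<^sub>R b) \<bullet> y"
      by (auto simp: expconj_pos_iff)
    then have cd: "c + e * (y \<bullet> b) \<le> \<psi> y - x \<bullet> y" "d - e * (y \<bullet> b) \<le> \<psi> y - x \<bullet> y" for y
      by (simp_all add: inner_add_left inner_diff_left inner_commute[of y] algebra_simps)
    have "min c d + e * \<bar>y \<bullet> b\<bar> \<le> \<psi> y - x \<bullet> y" for y
      using cd[of y] by (cases "0 \<le> y \<bullet> b") (auto simp: abs_if)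
    then show ?thesis by blast
  qed
  then obtain c where c: "\<And>b y. b \<in> Basis \<Longrightarrow> c b + e * \<bar>y \<bullet> b\<bar> \<le> \<psi> y - x \<bullet> y"
    by metis
  show ?thesis
  proof (rule that[of "e / DIM('a)" "- sum c Basis / DIM('a)"])
    show "e / DIM('a) > 0" using e by simp
    fix y :: 'a
    have "sum c Basis + e * norm y \<le> sum c Basis + e * (\<Sum>b\<in>Basis. \<bar>y \<bullet> b\<bar>)"
      using norm_le_l1[of y] e by simp
    also have "\<dots> = (\<Sum>b\<in>Basis. c b + e * \<bar>y \<bullet> b\<bar>)"
      by (simp add: sum.distrib sum_distrib_left)
    also have "\<dots> \<le> (\<Sum>b\<in>(Basis::'a set). \<psi> y - x \<bullet> y)"
      by (intro sum_mono c)
    also have "\<dots> = DIM('a) * (\<psi> y - x \<bullet> y)" by simp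
    finally show "\<psi> y - x \<bullet> y \<ge> e / DIM('a) * norm y - - sum c Basis / DIM('a)"
      by (simp add: field_simps)
  qed
qed

lemma expconj_diff_const: "expconj UNIV (\<lambda>y. \<psi> y - c) x = exp (- c) * expconj UNIV \<psi> x"
proof (rule antisym)
  show "expconj UNIV (\<lambda>y. \<psi> y - c) x \<le> exp (- c) * expconj UNIV \<psi> x"
    by (rule expconj_perturb_le) simp
  have "expconj UNIV \<psi> x \<le> exp c * expconj UNIV (\<lambda>y. \<psi> y - c) x"
    by (rule expconj_perturb_le) simp
  then show "exp (- c) * expconj UNIV \<psi> x \<le> expconj UNIV (\<lambda>y. \<psi> y - c) x"
    by (simp add: exp_minus field_simps)
qed

lemma expconj_le_1: "\<psi> 0 = 0 \<Longrightarrow> expconj UNIV \<psi> x \<le> 1"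
  using expconj_le[of 0 UNIV \<psi> x] by simp

text \<open>The bound is uniform in \<open>x\<close> and in \<open>t\<close>, so that after
  multiplication by an integrable weight it serves as the dominating function when the perturbed
  integral is differentiated.\<close>

lemma expconj_difference_quotient_bound:
  fixes \<psi> :: "'a::euclidean_space \<Rightarrow> real"
  assumes \<eta>: "\<And>y. \<bar>\<eta> y\<bar> \<le> m" and t: "0 < t" "t \<le> 1"
  shows "\<bar>(expconj UNIV (\<lambda>y. \<psi> y + t * \<eta> y) x - expconj UNIV \<psi> x) / t\<bar>
           \<le> exp (\<psi> 0) * (m * exp m)"
proof -
  let ?E = "expconj UNIV \<psi> x" and ?F = "expconj UNIV (\<lambda>y. \<psi> y + t * \<eta> y) x"
  have m: "m \<ge> 0" using \<eta>[of 0] by linarith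
  have E: "0 \<le> ?E" "?E \<le> exp (\<psi> 0)"
    using expconj_nonneg[of UNIV \<psi> x] expconj_le[of 0 UNIV \<psi> x] by auto
  have tm: "\<bar>t * \<eta> y\<bar> \<le> t * m" for y using \<eta>[of y] t by (simp add: abs_mult)
  have "?F \<le> exp (t * m) * ?E"
  proof (rule expconj_perturb_le)
    show "\<psi> y + t * \<eta> y \<le> \<psi> y + t * m" for y using tm[of y] by linarith
  qed
  have "?E \<le> exp (t * m) * ?F"
  proof (rule expconj_perturb_le)
    show "\<psi> y \<le> \<psi> y + t * \<eta> y + t * m" for y using tm[of y] by linarith
  qed
  then have "exp (- (t * m)) * ?E \<le> ?F" by (simp add: exp_minus field_simps)
  have tm1: "t * m \<le> m" using t m by (simp add: mult_left_le_one_le)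
  \<comment> \<open>With \<open>s = t * m\<close>, multiplying \<open>1 - s \<le> exp (- s)\<close>
    by \<open>exp s\<close> gives \<open>exp s - 1 \<le> s * exp s\<close>; since
    \<open>s \<le> m\<close> this is the origin of the factor \<open>m * exp m\<close>.\<close>
  have "1 - t * m \<le> exp (- (t * m))" using exp_ge_add_one_self[of "- (t * m)"] by simp
  have "exp (t * m) * (1 - t * m) \<le> exp (t * m) * exp (- (t * m))"
    by (intro mult_left_mono) (use \<open>1 - t * m \<le> _\<close> in auto)
  then have "exp (t * m) - 1 \<le> t * m * exp (t * m)"
    by (simp add: algebra_simps flip: exp_add)
  also have "\<dots> \<le> t * m * exp m" using t m tm1 by (intro mult_left_mono) auto
  finally have up: "exp (t * m) - 1 \<le> t * m * exp m" .
  have "1 - exp (- (t * m)) \<le> t * m * 1"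
    using \<open>1 - t * m \<le> _\<close> by simp
  also have "\<dots> \<le> t * m * exp m" using t m by (intro mult_left_mono) auto
  finally have lo: "1 - exp (- (t * m)) \<le> t * m * exp m" .
  have "?F - ?E \<le> (exp (t * m) - 1) * ?E" "?E - ?F \<le> (1 - exp (- (t * m))) * ?E"
    using \<open>?F \<le> _\<close> \<open>_ \<le> ?F\<close> by (simp_all add: algebra_simps)
  moreover have "(exp (t * m) - 1) * ?E \<le> t * m * exp m * ?E"
    "(1 - exp (- (t * m))) * ?E \<le> t * m * exp m * ?E"
    using up lo E by (auto intro: mult_right_mono)
  moreover have "t * m * exp m * ?E \<le> t * m * exp m * exp (\<psi> 0)"
    using E t m by (intro mult_left_mono) auto
  ultimately have "\<bar>?F - ?E\<bar> \<le> t * (exp (\<psi> 0) * (m * exp m))"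
    unfolding abs_le_iff by (simp add: algebra_simps)
  then show ?thesis using t by (simp add: abs_divide divide_le_eq mult.commute)
qed

section \<open>Measure-theoretic preliminaries\<close>

text \<open>Fubini without splitting the space into a line and a hyperplane: all translates of
  \<open>N\<close> by \<open>s e\<close> with \<open>s\<close> in \<open>[0, 1]\<close> have the
  same measure, so this measure equals its average over \<open>s\<close>; after exchanging the
  integrals, the inner one is over a line section and vanishes.\<close>

lemma null_set_lborel_if_lines_null:
  fixes N :: "'a::euclidean_space set"
  assumes N [measurable]: "N \<in> sets borel"
    and lines: "\<And>x. {s. x + s *\<^sub>R e \<in> N} \<in> null_sets lborel"
  shows "N \<in> null_sets lborel"
proof -
  have shift: "(\<integral>\<^sup>+ x. indicator N (x + s *\<^sub>R e) \<partial>lborel) = emeasure lborel N" for s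
  proof -
    have "(\<integral>\<^sup>+ x. indicator N x \<partial>lborel) = (\<integral>\<^sup>+ x. indicator N x \<partial>distr lborel borel ((+) (s *\<^sub>R e)))"
      by (simp add: lborel_distr_plus)
    also have "\<dots> = (\<integral>\<^sup>+ x. indicator N (x + s *\<^sub>R e) \<partial>lborel)"
      by (subst nn_integral_distr) (auto simp: add.commute)
    finally show ?thesis by simp
  qed
  have meas: "(\<lambda>(x, s). indicator N (x + s *\<^sub>R e) * indicator {0..1} s :: ennreal)
      \<in> borel_measurable (lborel \<Otimes>\<^sub>M (lborel :: real measure))"
    by measurable
  have "emeasure lborel N = (\<integral>\<^sup>+ s. emeasure lborel N * indicator {0..1} s \<partial>(lborel :: real measure))"
    by (simp add: nn_integral_cmult)
  also have "\<dots> = (\<integral>\<^sup>+ s. (\<integral>\<^sup>+ x. indicator N (x + s *\<^sub>R e) * indicator {0..1} s \<partial>lborel) \<partial>(lborel :: real measure))"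
    by (subst nn_integral_multc) (simp_all add: shift)
  also have "\<dots> = (\<integral>\<^sup>+ x. (\<integral>\<^sup>+ s. indicator N (x + s *\<^sub>R e) * indicator {0..1} s \<partial>(lborel :: real measure)) \<partial>lborel)"
    using lborel_pair.Fubini'[OF meas] by simp
  also have "\<dots> = (\<integral>\<^sup>+ x. 0 \<partial>(lborel :: 'a measure))"
  proof (rule nn_integral_cong)
    fix x :: 'a
    have "AE s in lborel. s \<notin> {s. x + s *\<^sub>R e \<in> N}"
      by (rule AE_not_in[OF lines])
    then have "AE s in lborel. indicator N (x + s *\<^sub>R e) * indicator {0..1} s = (0 :: ennreal)"
      by eventually_elim (auto simp: indicator_def)
    then show "(\<integral>\<^sup>+ s. indicator N (x + s *\<^sub>R e) * indicator {0..1} s \<partial>(lborel :: real measure)) = 0"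
      by (subst nn_integral_0_iff_AE) auto
  qed
  finally show ?thesis by (auto simp: null_sets_def)
qed

lemma distr_uminus_lborel:
  "distr lborel borel uminus = (lborel :: 'a::euclidean_space measure)"
proof -
  have "density (distr lborel borel (\<lambda>x::'a. 0 + (-1) *\<^sub>R x)) (\<lambda>_. ennreal (\<bar>-1\<bar> ^ DIM('a))) = lborel"
    by (rule lborel_affine[symmetric]) simp
  then show ?thesis by (simp add: density_1)
qed

lemma integral_lborel_uminus:
  fixes f :: "'a::euclidean_space \<Rightarrow> real"
  assumes "f \<in> borel_measurable borel"
  shows "(\<integral>x. f (- x) \<partial>lborel) = (\<integral>x. f x \<partial>lborel)"
proof -
  have "(\<integral>x. f x \<partial>distr lborel borel uminus) = (\<integral>x. f (- x) \<partial>lborel)"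
    using assms by (intro integral_distr) auto
  then show ?thesis by (simp add: distr_uminus_lborel)
qed

text \<open>Closed sets form an intersection-stable generator of the Borel sets containing the whole
  space, and their indicators are limits of bounded continuous functions.\<close>

lemma measure_eqI_bounded_continuous:
  fixes \<mu> \<nu> :: "'a::metric_space measure"
  assumes sets: "sets \<mu> = sets borel" "sets \<nu> = sets borel"
    and fin: "finite_measure \<mu>" "finite_measure \<nu>"
    and eq: "\<And>f::'a \<Rightarrow> real. continuous_on UNIV f \<Longrightarrow> (\<And>x. \<bar>f x\<bar> \<le> 1) \<Longrightarrow>
               (\<integral>x. f x \<partial>\<mu>) = (\<integral>x. f x \<partial>\<nu>)"
  shows "\<mu> = \<nu>"
proof -
  interpret M: finite_measure \<mu> by fact
  interpret N: finite_measure \<nu> by fact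
  have space: "space \<mu> = UNIV" "space \<nu> = UNIV"
    using sets[THEN sets_eq_imp_space_eq] by simp_all
  note sets [measurable_cong]
  have conv: "(\<lambda>n. \<integral>x. max 0 (1 - real n * infdist x C) \<partial>M) \<longlonglongrightarrow> measure M C"
    if C: "closed C" "C \<noteq> {}" and M: "finite_measure M" "sets M = sets borel" for C :: "'a set" and M
  proof -
    interpret finite_measure M by fact
    have space: "space M = UNIV" using sets_eq_imp_space_eq[OF M(2)] by simp
    note M(2) [measurable_cong]
    have [measurable]: "C \<in> sets borel" using C by simp
    have [measurable]: "(\<lambda>x. infdist x C) \<in> borel_measurable borel"
      by (intro borel_measurable_continuous_onI continuous_intros)
    have "(\<lambda>n. \<integral>x. max 0 (1 - real n * infdist x C) \<partial>M) \<longlonglongrightarrow> (\<integral>x. indicator C x \<partial>M)"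
    proof (rule integral_dominated_convergence[where w = "\<lambda>_. 1"])
      show "AE x in M. (\<lambda>n. max 0 (1 - real n * infdist x C)) \<longlonglongrightarrow> indicator C x"
      proof (rule AE_I2)
        fix x
        show "(\<lambda>n. max 0 (1 - real n * infdist x C)) \<longlonglongrightarrow> indicator C x"
        proof (cases "x \<in> C")
          case True
          then show ?thesis by simp
        next
          case False
          then have pos: "infdist x C > 0"
            using C infdist_nonneg[of x C] in_closed_iff_infdist_zero[of C x] by linarith
          obtain n0 :: nat where n0: "1 / infdist x C < n0"
            using reals_Archimedean2 by blast
          have "max 0 (1 - real n * infdist x C) = 0" if "n \<ge> n0" for n
          proof -
            have "1 / infdist x C < n" using n0 that by linarith
            then show ?thesis using pos by (simp add: field_simps)
          qed
          then have "\<forall>\<^sub>F n in sequentially. max 0 (1 - real n * infdist x C) = 0"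
            by (auto simp: eventually_sequentially)
          then show ?thesis using False by (simp add: tendsto_eventually)
        qed
      qed
    qed (auto intro!: AE_I2 simp: infdist_nonneg abs_le_iff)
    then show ?thesis using space by simp
  qed
  have closed_eq: "measure \<mu> C = measure \<nu> C" if C: "closed C" for C
  \<comment> \<open>The empty set is separated because \<open>infdist x {}\<close> is 0 by
    convention, so the approximating functions would be constantly 1 there.\<close>
  proof (cases "C = {}")
    case False
    have "(\<integral>x. max 0 (1 - real n * infdist x C) \<partial>\<mu>) = (\<integral>x. max 0 (1 - real n * infdist x C) \<partial>\<nu>)" for n
      by (intro eq continuous_intros) (auto simp: infdist_nonneg abs_le_iff)
    then show ?thesis
      using conv[OF C False fin(1) sets(1)] conv[OF C False fin(2) sets(2)] LIMSEQ_unique by simp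
  qed simp
  show ?thesis
  proof (rule measure_eqI_generator_eq[where E = "Collect closed" and A = "\<lambda>_. UNIV" and \<Omega> = UNIV])
    show "Int_stable (Collect closed)" by (auto simp: Int_stable_def)
    show "sets \<mu> = sigma_sets UNIV (Collect closed)" "sets \<nu> = sigma_sets UNIV (Collect closed)"
      using sets by (simp_all add: borel_eq_closed)
  qed (auto simp: closed_eq M.emeasure_eq_measure N.emeasure_eq_measure)
qed

text \<open>An Arzela-Ascoli argument for pointwise convergence: a diagonal subsequence converges on
  a countable dense set, and the common Lipschitz bound carries the Cauchy property to all
  points.\<close>

lemma lipschitz_convergent_subsequence:
  fixes f :: "nat \<Rightarrow> 'a::euclidean_space \<Rightarrow> real"
  assumes lip: "\<And>n x y. \<bar>f n x - f n y\<bar> \<le> norm (x - y)" and zero: "\<And>n. f n 0 = 0"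
  obtains k g where "strict_mono k" "\<And>x. (\<lambda>n. f (k n) x) \<longlonglongrightarrow> g x"
proof -
  obtain D :: "'a set" where D: "countable D" "\<And>X. open X \<Longrightarrow> X \<noteq> {} \<Longrightarrow> \<exists>d\<in>D. d \<in> X"
    using countable_dense_setE by blast
  \<comment> \<open>The diagonal extraction expects one bound for all points, whereas
    \<open>f n x\<close> is only bounded by \<open>norm x\<close>; dividing by
    \<open>1 + norm x\<close> normalises it and does not affect convergence at a fixed
    point.\<close>
  have "norm (f n x / (1 + norm x)) \<le> 1" for n x
  proof -
    have "\<bar>f n x\<bar> \<le> norm x" using lip[of n x 0] zero[of n] by simp
    then show ?thesis by (simp add: divide_le_eq)
  qed
  from function_convergent_subsequence[where f = "\<lambda>n x. f n x / (1 + norm x)", OF D(1) this]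
  obtain k :: "nat \<Rightarrow> nat" where k: "strict_mono k" "\<And>x. x \<in> D \<Longrightarrow> \<exists>l. (\<lambda>n. f (k n) x / (1 + norm x)) \<longlonglongrightarrow> l"
    by metis
  have convD: "convergent (\<lambda>n. f (k n) x)" if x: "x \<in> D" for x
  proof -
    obtain l where l: "(\<lambda>n. f (k n) x / (1 + norm x)) \<longlonglongrightarrow> l" using k x by blast
    have "1 + norm x \<noteq> 0" using norm_ge_zero[of x] by linarith
    then show ?thesis
      using tendsto_mult_right[OF l, of "1 + norm x"] by (auto simp: convergent_def)
  qed
  have "convergent (\<lambda>n. f (k n) x)" for x
  proof (rule Cauchy_convergent, rule metric_CauchyI)
    fix e :: real assume e: "e > 0"
    obtain d where d: "d \<in> D" "d \<in> ball x (e / 3)"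
      using D(2)[of "ball x (e / 3)"] e by auto
    obtain M where M: "\<And>m n. m \<ge> M \<Longrightarrow> n \<ge> M \<Longrightarrow> dist (f (k m) d) (f (k n) d) < e / 3"
      using metric_CauchyD[OF convergent_Cauchy[OF convD[OF d(1)]], of "e / 3"] e by auto
    have "dist (f (k m) x) (f (k n) x) < e" if "m \<ge> M" "n \<ge> M" for m n
      using M[OF that] lip[of "k m" x d] lip[of "k n" x d] d unfolding dist_norm mem_ball real_norm_def by linarith
    then show "\<exists>M. \<forall>m\<ge>M. \<forall>n\<ge>M. dist (f (k m) x) (f (k n) x) < e" by blast
  qed
  then have "(\<lambda>n. f (k n) x) \<longlonglongrightarrow> lim (\<lambda>n. f (k n) x)" for x
    by (simp add: convergent_LIMSEQ_iff)
  then show ?thesis by (rule that[OF k(1)])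
qed

text \<open>Dyadic balls replace polar coordinates. On the shell between radii
  \<open>r k / 2\<close> and \<open>r k\<close> the integrand is comparable to
  \<open>r k powr (q - d)\<close>; multiplied by the volume of the ball this is of order
  \<open>r k powr q\<close>, a geometric series with ratio \<open>(1/2) powr q\<close>, which is
  below 1 because \<open>q > 0\<close>.\<close>

lemma nn_integral_norm_powr_unit_ball:
  fixes q :: real
  assumes "q > 0"
  shows "(\<integral>\<^sup>+ x. ennreal (norm x powr (q - DIM('a))) * indicator (cball 0 1) x \<partial>(lborel :: 'a::euclidean_space measure)) < \<infinity>"
proof -
  define d :: real where "d = DIM('a)"
  \<comment> \<open>For exponent \<open>q - d \<ge> 0\<close> the outer radius of the shell bounds
    the power with constant 1; for a negative exponent the inner radius \<open>r k / 2\<close> is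
    the extreme one and costs \<open>2 powr (d - q)\<close>.\<close>
  define c where "c = max 1 (2 powr (d - q))"
  define r :: "nat \<Rightarrow> real" where "r k = (1/2) ^ k" for k
  have r: "r k > 0" for k by (simp add: r_def)
  have pw: "(1/2) powr real k = r k" for k by (simp add: r_def powr_realpow)
  have ptw: "ennreal (norm x powr (q - d)) * indicator (cball 0 1) x
      \<le> (\<Sum>k. ennreal (c * r k powr (q - d)) * indicator (cball 0 (r k)) x)" if "x \<noteq> 0" for x :: 'a
  proof (cases "norm x \<le> 1")
    case True
    have nx: "norm x > 0" using that by simp
    \<comment> \<open>The index of the dyadic shell containing \<open>x\<close>; the logarithm to
      base 1/2 is nonnegative on the unit ball.\<close>
    define k where "k = nat \<lfloor>log (1/2) (norm x)\<rfloor>"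
    have "log (1/2) (norm x) \<ge> 0"
      using nx True by (simp add: log_def ln_div divide_nonpos_pos)
    then have k: "real k \<le> log (1/2) (norm x)" "log (1/2) (norm x) < real k + 1"
      by (auto simp: k_def)
    have eq: "(1/2) powr (log (1/2) (norm x)) = norm x" using nx by simp
    have up: "norm x \<le> r k"
      using powr_mono'[of "real k" "log (1/2) (norm x)" "1/2"] k(1) eq pw by simp
    have "(1/2) powr (real k + 1) \<le> norm x"
      using powr_mono'[of "log (1/2) (norm x)" "real k + 1" "1/2"] k(2) eq by simp
    then have lo: "r k / 2 \<le> norm x" by (simp add: powr_add pw)
    have "norm x powr (q - d) \<le> c * r k powr (q - d)"
    proof (cases "q \<ge> d")
      case True
      have "norm x powr (q - d) \<le> r k powr (q - d)"
        using up True nx by (intro powr_mono2) auto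
      also have "\<dots> \<le> c * r k powr (q - d)" 
        using mult_right_mono[of 1 c "r k powr (q - d)"] by (simp add: c_def)
      finally show ?thesis .
    next
      case False
      have "norm x powr (q - d) \<le> (r k / 2) powr (q - d)"
        using lo False r[of k] nx by (intro powr_mono2') auto
      also have "\<dots> = 2 powr (d - q) * r k powr (q - d)"
        using r[of k] by (simp add: powr_divide powr_diff field_simps)
      also have "\<dots> \<le> c * r k powr (q - d)"
        by (intro mult_right_mono) (auto simp: c_def)
      finally show ?thesis .
    qed
    then have "ennreal (norm x powr (q - d)) * indicator (cball 0 1) x
       \<le> ennreal (c * r k powr (q - d)) * indicator (cball 0 (r k)) x"
      using True up by (auto simp: indicator_def intro: ennreal_leI)
    also have "\<dots> = (\<Sum>k\<in>{k}. ennreal (c * r k powr (q - d)) * indicator (cball 0 (r k)) x)"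
      by (simp only: sum.insert sum.empty finite.emptyI empty_iff not_False_eq_True add_0_right)
    also have "\<dots> \<le> (\<Sum>k. ennreal (c * r k powr (q - d)) * indicator (cball 0 (r k)) x)"
      by (rule sum_le_suminf[OF summableI]) simp_all
    finally show ?thesis .
  qed simp
  have "(\<integral>\<^sup>+ x. ennreal (norm x powr (q - d)) * indicator (cball 0 1) x \<partial>(lborel :: 'a measure))
      \<le> (\<integral>\<^sup>+ x. (\<Sum>k. ennreal (c * r k powr (q - d)) * indicator (cball 0 (r k)) x) \<partial>(lborel :: 'a measure))"
    using AE_lborel_singleton[of "0::'a"]
    by (intro nn_integral_mono_AE) (auto elim!: eventually_mono intro: ptw)
  also have "\<dots> = (\<Sum>k. (\<integral>\<^sup>+ x. ennreal (c * r k powr (q - d)) * indicator (cball 0 (r k)) x \<partial>(lborel :: 'a measure)))"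
    by (rule nn_integral_suminf) (intro borel_measurable_times_ennreal borel_measurable_const borel_measurable_indicator, simp)
  also have "\<dots> = (\<Sum>k. ennreal (c * r k powr (q - d)) * emeasure lborel (cball (0::'a) (r k)))"
    by (intro suminf_cong nn_integral_cmult_indicator) simp
  also have "\<dots> = (\<Sum>k. ennreal (c * unit_ball_vol d * ((1/2) powr q) ^ k))"
  proof (rule suminf_cong)
    fix k
    have "r k powr (q - d) * r k ^ DIM('a) = r k powr q"
      using r[of k] by (simp add: d_def powr_diff powr_realpow)
    also have "\<dots> = ((1/2) powr q) ^ k"
    proof -
      have "r k powr q = (1/2) powr (q * real k)"
        unfolding pw[symmetric] powr_powr by (simp only: mult.commute)
      also have "\<dots> = ((1/2) powr q) powr real k"
        by (simp only: powr_powr)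
      also have "\<dots> = ((1/2) powr q) ^ k"
        by (rule powr_realpow) simp
      finally show ?thesis .
    qed
    finally have "c * r k powr (q - d) * (unit_ball_vol d * r k ^ DIM('a))
        = c * unit_ball_vol d * ((1/2) powr q) ^ k"
      by (metis (no_types, opaque_lifting) mult.assoc mult.left_commute)
    then show "ennreal (c * r k powr (q - d)) * emeasure lborel (cball (0::'a) (r k))
        = ennreal (c * unit_ball_vol d * ((1/2) powr q) ^ k)"
      using r[of k] by (simp add: emeasure_cball d_def ennreal_mult[symmetric] c_def)
  qed
  also have "\<dots> < \<infinity>"
  proof -
    have "(1/2) powr q < 1" using powr_less_mono2[of q "1/2" 1] assms by simp
    then have "summable (\<lambda>k. c * unit_ball_vol d * ((1/2) powr q) ^ k)"
      by (intro summable_mult summable_geometric) auto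
    moreover have "0 \<le> c * unit_ball_vol d * ((1/2) powr q) ^ k" for k
      by (auto simp: c_def d_def intro!: mult_nonneg_nonneg unit_ball_vol_nonneg)
    ultimately show ?thesis by (simp add: suminf_ennreal2)
  qed
  finally show ?thesis by (simp add: d_def)
qed

section \<open>The gradient map\<close>

lemma exp_difference_quotient_tendsto:
  "((\<lambda>t. (exp (t * a) - 1) / t) \<longlongrightarrow> a) (at_right (0::real))"
proof -
  have "((\<lambda>t. exp (t * a)) has_real_derivative a) (at 0)"
    by (auto intro!: derivative_eq_intros)
  then show ?thesis
    unfolding has_field_derivative_iff by (auto intro: tendsto_mono[OF at_le])
qed

text \<open>The contact set of \<open>\<psi>\<close> with its supporting affine function of slope
  \<open>x\<close>; empty if there is no such contact.\<close>

definition tilt_argmin :: "('a::euclidean_space \<Rightarrow> real) \<Rightarrow> 'a \<Rightarrow> 'a set" where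
  "tilt_argmin \<psi> x = {y. \<forall>z. \<psi> y - x \<bullet> y \<le> \<psi> z - x \<bullet> z}"

text \<open>The interior is taken because coercivity, and with it attainment of the infimum, is
  available there.\<close>

definition expconj_dom :: "('a::euclidean_space \<Rightarrow> real) \<Rightarrow> 'a set" where
  "expconj_dom \<psi> = interior {x. expconj UNIV \<psi> x > 0}"

definition unique_argmin :: "('a::euclidean_space \<Rightarrow> real) \<Rightarrow> 'a set" where
  "unique_argmin \<psi> = {x \<in> expconj_dom \<psi>. \<exists>!y. y \<in> tilt_argmin \<psi> x}"

text \<open>For continuous \<open>\<psi>\<close> the default 0 is used, up to a null set, only where
  \<open>expconj UNIV \<psi>\<close> vanishes. Being its own negative, it keeps the map odd at every
  point when \<open>\<psi>\<close> is even.\<close>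

definition tilt_map :: "('a::euclidean_space \<Rightarrow> real) \<Rightarrow> 'a \<Rightarrow> 'a" where
  "tilt_map \<psi> x = (if x \<in> unique_argmin \<psi> then THE y. y \<in> tilt_argmin \<psi> x else 0)"

lemma expconj_attained: "y \<in> tilt_argmin \<psi> x \<Longrightarrow> expconj UNIV \<psi> x = exp (\<psi> y - x \<bullet> y)"
  by (intro antisym expconj_le expconj_greatest) (auto simp: tilt_argmin_def)

text \<open>Adding the two optimality inequalities cancels \<open>\<psi>\<close>; this is the
  monotonicity of a subdifferential, here without reference to convexity.\<close>

lemma tilt_argmin_monotone:
  assumes "y \<in> tilt_argmin \<psi> x" "y' \<in> tilt_argmin \<psi> x'"
  shows "0 \<le> (x' - x) \<bullet> (y' - y)"
proof -
  have "\<psi> y - x \<bullet> y \<le> \<psi> y' - x \<bullet> y'" "\<psi> y' - x' \<bullet> y' \<le> \<psi> y - x' \<bullet> y"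
    using assms by (auto simp: tilt_argmin_def)
  then show ?thesis by (simp add: inner_diff_left inner_diff_right)
qed

lemma expconj_dom_pos: "x \<in> expconj_dom \<psi> \<Longrightarrow> expconj UNIV \<psi> x > 0"
  using interior_subset unfolding expconj_dom_def by blast

lemma tilt_map_eq: "x \<in> unique_argmin \<psi> \<Longrightarrow> y \<in> tilt_argmin \<psi> x \<Longrightarrow> tilt_map \<psi> x = y"
  by (auto simp: tilt_map_def unique_argmin_def)

lemma tilt_map_in: "x \<in> unique_argmin \<psi> \<Longrightarrow> tilt_map \<psi> x \<in> tilt_argmin \<psi> x"
  unfolding tilt_map_def by (auto simp: unique_argmin_def intro: theI2)

lemma open_expconj_dom: "open (expconj_dom \<psi>)"
  by (simp add: expconj_dom_def)

section \<open>Minimisers of the tilted function: Borel measurability and almost everywhere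
  uniqueness\<close>

context
  fixes \<psi> :: "'a::euclidean_space \<Rightarrow> real"
  assumes cont: "continuous_on UNIV \<psi>"
begin

lemma continuous_tilt: "continuous_on UNIV (\<lambda>y. \<psi> y - x \<bullet> y)"
  by (intro continuous_intros cont)

lemma tilt_attains_inf:
  assumes "x \<in> expconj_dom \<psi>" "closed C" "C \<noteq> {}"
  obtains y where "y \<in> C" "\<And>z. z \<in> C \<Longrightarrow> \<psi> y - x \<bullet> y \<le> \<psi> z - x \<bullet> z"
proof -
  obtain r b where "r > 0" "\<And>y. \<psi> y - x \<bullet> y \<ge> r * norm y - b"
    using expconj_coercive assms(1) unfolding expconj_dom_def by blast
  from coercive_attains_inf[OF continuous_tilt this assms(2,3)] that show ?thesis by blast
qed

lemma tilt_argmin_nonempty: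
  assumes "x \<in> expconj_dom \<psi>"
  shows "\<exists>y. y \<in> tilt_argmin \<psi> x"
  using tilt_attains_inf[OF assms, of UNIV] by (auto simp: tilt_argmin_def)

text \<open>This is the purpose of the parameter \<open>C\<close> in \<open>expconj\<close>: the
  condition that some minimiser lies in \<open>C\<close> becomes an equation between two Borel
  functions of \<open>x\<close>. Closedness of \<open>C\<close> makes the restricted infimum
  attained.\<close>

lemma tilt_argmin_meets_iff:
  assumes x: "x \<in> expconj_dom \<psi>" and C: "closed C" "C \<noteq> {}"
  shows "(\<exists>y\<in>C. y \<in> tilt_argmin \<psi> x) \<longleftrightarrow> expconj C \<psi> x = expconj UNIV \<psi> x"
proof
  assume "\<exists>y\<in>C. y \<in> tilt_argmin \<psi> x"
  then obtain y where y: "y \<in> C" "y \<in> tilt_argmin \<psi> x" by blast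
  show "expconj C \<psi> x = expconj UNIV \<psi> x"
  proof (rule antisym)
    show "expconj C \<psi> x \<le> expconj UNIV \<psi> x"
      using expconj_le[OF y(1)] expconj_attained[OF y(2)] by simp
    show "expconj UNIV \<psi> x \<le> expconj C \<psi> x"
      by (intro expconj_greatest expconj_le) (use C in auto)
  qed
next
  assume eq: "expconj C \<psi> x = expconj UNIV \<psi> x"
  obtain y where y: "y \<in> C" "\<And>z. z \<in> C \<Longrightarrow> \<psi> y - x \<bullet> y \<le> \<psi> z - x \<bullet> z"
    using tilt_attains_inf[OF x C] by blast
  have "exp (\<psi> y - x \<bullet> y) \<le> expconj C \<psi> x"
    using C y by (intro expconj_greatest) auto
  then have "exp (\<psi> y - x \<bullet> y) \<le> exp (\<psi> z - x \<bullet> z)" for z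
    by (rule order_trans) (simp add: eq expconj_le)
  then have "y \<in> tilt_argmin \<psi> x" by (auto simp: tilt_argmin_def)
  with y show "\<exists>y\<in>C. y \<in> tilt_argmin \<psi> x" by blast
qed

lemma tilt_argmin_meets_borel:
  assumes C: "closed C"
  shows "{x \<in> expconj_dom \<psi>. \<exists>y\<in>C. y \<in> tilt_argmin \<psi> x} \<in> sets borel"
proof (cases "C = {}")
  case False
  have [measurable]: "expconj C \<psi> \<in> borel_measurable borel" "expconj UNIV \<psi> \<in> borel_measurable borel"
    "expconj_dom \<psi> \<in> sets borel"
    using False by (auto intro: borel_measurable_expconj borel_open open_expconj_dom)
  have "{x \<in> expconj_dom \<psi>. \<exists>y\<in>C. y \<in> tilt_argmin \<psi> x}
      = expconj_dom \<psi> \<inter> {x. expconj C \<psi> x = expconj UNIV \<psi> x}"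
    using tilt_argmin_meets_iff[OF _ C False] by blast
  also have "\<dots> \<in> sets borel" by measurable
  finally show ?thesis .
qed simp

text \<open>For \<open>p < r\<close> these are the points having two minimisers on opposite sides of
  a slab orthogonal to \<open>e\<close>. Each half-space is closed, so both conditions are
  Borel.\<close>

definition split_set :: "'a \<Rightarrow> real \<Rightarrow> real \<Rightarrow> 'a set" where
  "split_set e p r = {x \<in> expconj_dom \<psi>. \<exists>y\<in>{y. y \<bullet> e \<le> p}. y \<in> tilt_argmin \<psi> x} \<inter>
                     {x \<in> expconj_dom \<psi>. \<exists>y\<in>{y. r \<le> y \<bullet> e}. y \<in> tilt_argmin \<psi> x}"

lemma split_set_borel: "split_set e p r \<in> sets borel"
proof -
  have "closed {y::'a. y \<bullet> e \<le> p}" "closed {y::'a. r \<le> y \<bullet> e}"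
    by (intro closed_Collect_le continuous_intros)+
  then show ?thesis
    unfolding split_set_def by (intro sets.Int tilt_argmin_meets_borel)
qed

text \<open>By monotonicity every line in direction \<open>e\<close> meets \<open>split_set e p r\<close> in at most one point.\<close>

lemma split_set_null:
  assumes "p < r"
  shows "split_set e p r \<in> null_sets lborel"
proof (rule null_set_lborel_if_lines_null[OF split_set_borel])
  fix x
  let ?S = "{s. x + s *\<^sub>R e \<in> split_set e p r}"
  have le: "s' \<le> s" if "s \<in> ?S" "s' \<in> ?S" for s s'
  proof (rule ccontr)
    assume "\<not> s' \<le> s"
    obtain y where y: "y \<in> tilt_argmin \<psi> (x + s *\<^sub>R e)" "r \<le> y \<bullet> e"
      using \<open>s \<in> ?S\<close> by (auto simp: split_set_def)
    obtain y' where y': "y' \<in> tilt_argmin \<psi> (x + s' *\<^sub>R e)" "y' \<bullet> e \<le> p"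
      using \<open>s' \<in> ?S\<close> by (auto simp: split_set_def)
    have "x + s' *\<^sub>R e - (x + s *\<^sub>R e) = (s' - s) *\<^sub>R e"
      by (simp add: algebra_simps)
    then have "0 \<le> (s' - s) * (y' \<bullet> e - y \<bullet> e)"
      using tilt_argmin_monotone[OF y(1) y'(1)]
      by (simp add: inner_diff_right inner_commute[of e] right_diff_distrib)
    moreover have "(s' - s) * (y' \<bullet> e - y \<bullet> e) < 0"
      using \<open>\<not> s' \<le> s\<close> y(2) y'(2) assms by (intro mult_pos_neg) auto
    ultimately show False by simp
  qed
  have "?S = {} \<or> (\<exists>s. ?S = {s})"
    using le by (metis (no_types, lifting) antisym is_singletonI' is_singletonE)
  then have "finite ?S" by (metis finite.emptyI finite.insertI)
  then show "?S \<in> null_sets lborel" by (rule finite_imp_null_set_lborel)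
qed

text \<open>Distinct minimisers differ in some coordinate, and two rationals \<open>p < r\<close>
  fit strictly between the two values. Only countably many slabs are involved, so Borel
  measurability and nullity pass to the union.\<close>

lemma unique_argmin_eq:
  "unique_argmin \<psi> = expconj_dom \<psi> -
     (\<Union>(e, p, r)\<in>Basis \<times> {(p, r). p \<in> \<rat> \<and> r \<in> \<rat> \<and> p < r}. split_set e p r)"
proof (intro equalityI subsetI)
  fix x assume x: "x \<in> unique_argmin \<psi>"
  have "x \<notin> split_set e p r" if "p < r" for e p r
  proof
    assume "x \<in> split_set e p r"
    then obtain y y' where "y \<in> tilt_argmin \<psi> x" "y \<bullet> e \<le> p" "y' \<in> tilt_argmin \<psi> x" "r \<le> y' \<bullet> e"
      by (auto simp: split_set_def)
    moreover from this x have "y = y'" unfolding unique_argmin_def by blast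
    ultimately show False using that by simp
  qed
  with x show "x \<in> expconj_dom \<psi> -
     (\<Union>(e, p, r)\<in>Basis \<times> {(p, r). p \<in> \<rat> \<and> r \<in> \<rat> \<and> p < r}. split_set e p r)"
    by (auto simp: unique_argmin_def)
next
  fix x assume x: "x \<in> expconj_dom \<psi> -
     (\<Union>(e, p, r)\<in>Basis \<times> {(p, r). p \<in> \<rat> \<and> r \<in> \<rat> \<and> p < r}. split_set e p r)"
  have *: "\<not> y \<bullet> e < y' \<bullet> e" if "y \<in> tilt_argmin \<psi> x" "y' \<in> tilt_argmin \<psi> x" "e \<in> Basis" for y y' e
  proof
    assume "y \<bullet> e < y' \<bullet> e"
    then obtain p where p: "p \<in> \<rat>" "y \<bullet> e < p" "p < y' \<bullet> e" using Rats_dense_in_real by blast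
    then obtain r where r: "r \<in> \<rat>" "p < r" "r < y' \<bullet> e" using Rats_dense_in_real by blast
    have "x \<in> split_set e p r"
      using x that p r by (auto simp: split_set_def intro: less_imp_le)
    with x p r that show False by auto
  qed
  have "y = y'" if "y \<in> tilt_argmin \<psi> x" "y' \<in> tilt_argmin \<psi> x" for y y'
  proof (rule euclidean_eqI)
    fix b :: 'a assume "b \<in> Basis"
    then show "y \<bullet> b = y' \<bullet> b" using *[OF that, of b] *[OF that(2,1), of b] by linarith
  qed
  moreover have "x \<in> expconj_dom \<psi>" using x by simp
  ultimately show "x \<in> unique_argmin \<psi>"
    using tilt_argmin_nonempty[of x] unfolding unique_argmin_def by blast
qed

lemma countable_split_indices: "countable (Basis \<times> {(p, r). p \<in> \<rat> \<and> r \<in> \<rat> \<and> p < (r::real)})"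
proof (rule countable_SIGMA)
  have "{(p, r). p \<in> \<rat> \<and> r \<in> \<rat> \<and> p < (r::real)} \<subseteq> \<rat> \<times> \<rat>" by auto
  then show "countable {(p, r). p \<in> \<rat> \<and> r \<in> \<rat> \<and> p < (r::real)}"
    by (rule countable_subset) (simp add: countable_rat)
qed (simp add: countable_finite)

lemma unique_argmin_borel: "unique_argmin \<psi> \<in> sets borel"
  unfolding unique_argmin_eq
proof (intro sets.Diff sets.countable_UN' countable_split_indices)
  show "expconj_dom \<psi> \<in> sets borel" by (simp add: open_expconj_dom)
qed (auto simp: split_set_borel)

lemma AE_unique_argmin:
  "AE x in lborel. expconj UNIV \<psi> x > 0 \<longrightarrow> x \<in> unique_argmin \<psi>"
proof -
  have "AE x in lborel. \<forall>i\<in>Basis \<times> {(p, r). p \<in> \<rat> \<and> r \<in> \<rat> \<and> p < r}.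
      x \<notin> (case i of (e, p, r) \<Rightarrow> split_set e p r)"
    unfolding AE_ball_countable[OF countable_split_indices]
    by (auto intro!: AE_not_in split_set_null)
  with AE_expconj_pos_interior[of \<psi>] show ?thesis
    by eventually_elim (auto simp: unique_argmin_eq expconj_dom_def)
qed

lemma borel_measurable_tilt_map [measurable]: "tilt_map \<psi> \<in> borel_measurable borel"
proof (rule borel_measurableI)
  fix S :: "'a set" assume "open S"
  \<comment> \<open>The Borel criterion speaks of closed sets meeting the argmin. Where the
    minimiser is unique, landing in the open set \<open>S\<close> means that the argmin misses the
    closed complement.\<close>
  then have "closed (- S)" by (rule closed_Compl)
  note [measurable] = tilt_argmin_meets_borel[OF this] unique_argmin_borel
  have "tilt_map \<psi> -` S = unique_argmin \<psi> - {x \<in> expconj_dom \<psi>. \<exists>y\<in>- S. y \<in> tilt_argmin \<psi> x}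
     \<union> (if 0 \<in> S then - unique_argmin \<psi> else {})"
  proof -
    have "tilt_map \<psi> x \<in> S \<longleftrightarrow> \<not> (\<exists>y\<in>- S. y \<in> tilt_argmin \<psi> x)" if "x \<in> unique_argmin \<psi>" for x
      using tilt_map_in[OF that] tilt_map_eq[OF that] by blast
    moreover have "tilt_map \<psi> x = 0" if "x \<notin> unique_argmin \<psi>" for x
      using that by (simp add: tilt_map_def)
    moreover have "unique_argmin \<psi> \<subseteq> expconj_dom \<psi>"
      by (auto simp: unique_argmin_def)
    ultimately have "x \<in> tilt_map \<psi> -` S \<longleftrightarrow>
        x \<in> unique_argmin \<psi> - {x \<in> expconj_dom \<psi>. \<exists>y\<in>- S. y \<in> tilt_argmin \<psi> x}
          \<union> (if 0 \<in> S then - unique_argmin \<psi> else {})" for x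
      by (cases "x \<in> unique_argmin \<psi>"; cases "0 \<in> S") auto
    then show ?thesis by blast
  qed
  also have "\<dots> \<in> sets borel"
    by (cases "0 \<in> S") (simp_all add: sets.Un sets.Diff borel_comp)
  finally show "tilt_map \<psi> -` S \<inter> space borel \<in> sets borel" by simp
qed

section \<open>First-order expansions at points with a unique minimiser\<close>

lemma unique_argmin_linear_gap:
  assumes x: "x \<in> unique_argmin \<psi>" and "\<delta> > 0"
  obtains \<kappa> where "\<kappa> > 0" "\<And>y. norm (y - tilt_map \<psi> x) \<ge> \<delta> \<Longrightarrow>
    \<psi> y - x \<bullet> y \<ge> \<psi> (tilt_map \<psi> x) - x \<bullet> tilt_map \<psi> x + \<kappa> * norm (y - tilt_map \<psi> x)"
proof -
  have "x \<in> expconj_dom \<psi>" using x by (simp add: unique_argmin_def)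
  then obtain r b where rb: "r > 0" "\<And>y. \<psi> y - x \<bullet> y \<ge> r * norm y - b"
    using expconj_coercive unfolding expconj_dom_def by blast
  have "\<psi> (tilt_map \<psi> x) - x \<bullet> tilt_map \<psi> x < \<psi> y - x \<bullet> y" if "y \<noteq> tilt_map \<psi> x" for y
  proof (rule ccontr)
    assume "\<not> ?thesis"
    then have "y \<in> tilt_argmin \<psi> x"
      using tilt_map_in[OF x] unfolding tilt_argmin_def by (smt (verit) mem_Collect_eq)
    with tilt_map_eq[OF x] that show False by simp
  qed
  from coercive_linear_gap[OF continuous_tilt rb this \<open>\<delta> > 0\<close>] that show ?thesis by blast
qed

text \<open>The nontrivial half of differentiability. Points \<open>y\<close> at distance at least
  \<open>\<epsilon>\<close> from the minimiser cannot profit from the tilt \<open>h\<close>, because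
  the linear gap \<open>\<kappa>\<close> exceeds \<open>norm h\<close>; nearer points gain at most
  \<open>\<epsilon> * norm h\<close>. Hence \<open>\<kappa>\<close> itself is the radius
  \<open>d\<close>.\<close>

lemma expconj_tilt_bounds:
  assumes x: "x \<in> unique_argmin \<psi>" and \<epsilon>: "\<epsilon> > 0"
  obtains d where "d > 0" "\<And>h. norm h < d \<Longrightarrow>
    expconj UNIV \<psi> x * exp (- (h \<bullet> tilt_map \<psi> x) - \<epsilon> * norm h) \<le> expconj UNIV \<psi> (x + h)"
proof -
  let ?y0 = "tilt_map \<psi> x"
  have E: "expconj UNIV \<psi> x = exp (\<psi> ?y0 - x \<bullet> ?y0)"
    by (rule expconj_attained[OF tilt_map_in[OF x]])
  obtain \<kappa> where \<kappa>: "\<kappa> > 0" "\<And>y. norm (y - ?y0) \<ge> \<epsilon> \<Longrightarrow>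
    \<psi> y - x \<bullet> y \<ge> \<psi> ?y0 - x \<bullet> ?y0 + \<kappa> * norm (y - ?y0)"
    using unique_argmin_linear_gap[OF x \<epsilon>] by blast
  show ?thesis
  proof (rule that[OF \<kappa>(1)])
    fix h :: 'a assume h: "norm h < \<kappa>"
    have "\<psi> ?y0 - x \<bullet> ?y0 - h \<bullet> ?y0 - \<epsilon> * norm h \<le> \<psi> y - (x + h) \<bullet> y" for y
    proof -
      have cs: "h \<bullet> (y - ?y0) \<le> norm h * norm (y - ?y0)" by (rule norm_cauchy_schwarz)
      have "\<psi> ?y0 - x \<bullet> ?y0 + h \<bullet> (y - ?y0) \<le> \<psi> y - x \<bullet> y + \<epsilon> * norm h"
      proof (cases "norm (y - ?y0) \<ge> \<epsilon>")
        case True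
        have "norm h * norm (y - ?y0) \<le> \<kappa> * norm (y - ?y0)"
          using h by (intro mult_right_mono) auto
        moreover have "0 \<le> \<epsilon> * norm h" using \<epsilon> by simp
        ultimately show ?thesis using \<kappa>(2)[OF True] cs by linarith
      next
        case False
        then have "norm h * norm (y - ?y0) \<le> norm h * \<epsilon>"
          by (intro mult_left_mono) auto
        moreover have "\<psi> ?y0 - x \<bullet> ?y0 \<le> \<psi> y - x \<bullet> y"
          using tilt_map_in[OF x] by (simp add: tilt_argmin_def)
        ultimately show ?thesis using cs by (simp add: mult.commute)
      qed
      then show ?thesis by (simp add: inner_diff_right inner_add_left)
    qed
    then show "expconj UNIV \<psi> x * exp (- (h \<bullet> ?y0) - \<epsilon> * norm h) \<le> expconj UNIV \<psi> (x + h)"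
      unfolding E exp_add[symmetric] by (intro expconj_greatest) (auto simp: algebra_simps)
  qed
qed

text \<open>The potential is the conjugate of \<open>\<psi>\<close> minus \<open>ln c\<close>. One
  side of the first-order estimate comes from \<open>expconj_tilt_bounds\<close>, the other from
  testing the infimum at the old minimiser.\<close>

lemma has_gradient_potential_expconj:
  assumes x: "x \<in> unique_argmin \<psi>" and c: "c > 0"
  shows "has_gradient (potential (\<lambda>x. c * expconj UNIV \<psi> x)) x (tilt_map \<psi> x)"
  unfolding has_gradient_def gderiv_def
proof
  let ?E = "expconj UNIV \<psi>" and ?y0 = "tilt_map \<psi> x"
  let ?p = "potential (\<lambda>x. c * ?E x)"
  have dom: "x \<in> expconj_dom \<psi>" using x by (simp add: unique_argmin_def)
  have fin: "{y. \<bar>?p y\<bar> \<noteq> \<infinity>} = {y. ?E y > 0}"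
    using c expconj_nonneg[of UNIV \<psi>] by (auto simp: potential_def less_le)
  show "x \<in> interior {y. \<bar>?p y\<bar> \<noteq> \<infinity>}"
    using dom unfolding fin expconj_dom_def .
  have E: "?E x = exp (\<psi> ?y0 - x \<bullet> ?y0)"
    by (rule expconj_attained[OF tilt_map_in[OF x]])
  have p: "real_of_ereal (?p z) = - ln c - ln (?E z)" if "?E z > 0" for z
    using that c by (simp add: potential_def ln_mult)
  obtain d0 where d0: "d0 > 0" "ball x d0 \<subseteq> {y. ?E y > 0}"
    using dom unfolding expconj_dom_def mem_interior by blast
  show "((\<lambda>y. real_of_ereal (?p y)) has_derivative (\<lambda>h. h \<bullet> ?y0)) (at x)"
    unfolding has_derivative_at_alt
  proof (intro conjI allI impI)
    show "bounded_linear (\<lambda>h. h \<bullet> ?y0)" by (rule bounded_linear_inner_left)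
    fix e :: real assume "e > 0"
    from expconj_tilt_bounds[OF x this] obtain d where d: "d > 0" "\<And>h. norm h < d \<Longrightarrow>
       ?E x * exp (- (h \<bullet> ?y0) - e * norm h) \<le> ?E (x + h)" by blast
    show "\<exists>d>0. \<forall>y. norm (y - x) < d \<longrightarrow>
        norm (real_of_ereal (?p y) - real_of_ereal (?p x) - (y - x) \<bullet> ?y0) \<le> e * norm (y - x)"
    proof (intro exI conjI allI impI)
      show "min d d0 > 0" using d d0 by simp
      fix y assume y: "norm (y - x) < min d d0"
      have pos: "?E x > 0" "?E y > 0"
        using expconj_dom_pos[OF dom] d0(2) y by (auto simp: dist_norm norm_minus_commute)
      have "?E x * exp (- ((y - x) \<bullet> ?y0) - e * norm (y - x)) \<le> ?E y"
        using d(2)[of "y - x"] y by simp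
      then have "ln (?E x * exp (- ((y - x) \<bullet> ?y0) - e * norm (y - x))) \<le> ln (?E y)"
        using pos by (subst ln_le_cancel_iff) auto
      then have lo: "ln (?E x) - (y - x) \<bullet> ?y0 - e * norm (y - x) \<le> ln (?E y)"
        using pos by (simp add: ln_mult)
      have "?E y \<le> exp (\<psi> ?y0 - y \<bullet> ?y0)" by (rule expconj_le) simp
      then have "ln (?E y) \<le> ln (exp (\<psi> ?y0 - y \<bullet> ?y0))"
        using pos by (subst ln_le_cancel_iff) auto
      then have "ln (?E y) \<le> ln (?E x) - (y - x) \<bullet> ?y0"
        by (simp add: E inner_diff_left)
      with lo show "norm (real_of_ereal (?p y) - real_of_ereal (?p x) - (y - x) \<bullet> ?y0) \<le> e * norm (y - x)"
        unfolding p[OF pos(1)] p[OF pos(2)] real_norm_def abs_le_iff by linarith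
    qed
  qed
qed

text \<open>An envelope theorem. Testing at the old minimiser bounds the quotient from above; from
  below, continuity of \<open>\<eta>\<close> controls nearby points and the gap excludes distant
  ones.\<close>

lemma expconj_perturb_tendsto:
  assumes x: "x \<in> unique_argmin \<psi>" and \<eta>: "continuous_on UNIV \<eta>" "\<And>y. \<bar>\<eta> y\<bar> \<le> m"
  shows "((\<lambda>t. (expconj UNIV (\<lambda>y. \<psi> y + t * \<eta> y) x - expconj UNIV \<psi> x) / t)
          \<longlongrightarrow> expconj UNIV \<psi> x * \<eta> (tilt_map \<psi> x)) (at_right 0)"
proof -
  let ?y0 = "tilt_map \<psi> x" and ?E = "expconj UNIV \<psi> x"
  let ?F = "\<lambda>t. expconj UNIV (\<lambda>y. \<psi> y + t * \<eta> y) x"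
  have E: "?E = exp (\<psi> ?y0 - x \<bullet> ?y0)"
    by (rule expconj_attained[OF tilt_map_in[OF x]])
  have pos: "?E > 0" by (simp add: E)
  have lower: "\<forall>\<^sub>F t in at_right 0. ?E * (\<eta> ?y0 - \<epsilon>) \<le> (?F t - ?E) / t" if \<epsilon>: "\<epsilon> > 0" for \<epsilon>
  proof -
    have "isCont \<eta> ?y0" using \<eta>(1) by (simp add: continuous_on_eq_continuous_at)
    then obtain \<delta> where \<delta>: "\<delta> > 0" "\<And>y. dist y ?y0 < \<delta> \<Longrightarrow> dist (\<eta> y) (\<eta> ?y0) < \<epsilon>"
      using \<epsilon> unfolding continuous_at_eps_delta dist_norm by blast
    obtain \<kappa> where \<kappa>: "\<kappa> > 0" "\<And>y. norm (y - ?y0) \<ge> \<delta> \<Longrightarrow>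
      \<psi> y - x \<bullet> y \<ge> \<psi> ?y0 - x \<bullet> ?y0 + \<kappa> * norm (y - ?y0)"
      using unique_argmin_linear_gap[OF x \<delta>(1)] by blast
    have m: "m \<ge> 0" using \<eta>(2)[of 0] by linarith
    \<comment> \<open>Outside the \<open>\<delta>\<close>-ball the gap is at least
      \<open>\<kappa> * \<delta>\<close>, while values of \<open>\<eta>\<close> differ by at most
      \<open>2 * m\<close>; the summand 1 keeps the denominator positive when
      \<open>m = 0\<close>.\<close>
    define t0 where "t0 = \<kappa> * \<delta> / (2 * m + 1)"
    have t0: "t0 > 0" using \<kappa> \<delta> m by (simp add: t0_def)
    have "?E * (\<eta> ?y0 - \<epsilon>) \<le> (?F t - ?E) / t" if t: "t > 0" "t < t0" for t
    proof -
      have "\<psi> ?y0 - x \<bullet> ?y0 + t * (\<eta> ?y0 - \<epsilon>) \<le> \<psi> y + t * \<eta> y - x \<bullet> y" for y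
      proof (cases "norm (y - ?y0) \<ge> \<delta>")
        case True
        have "t * (2 * m) \<le> t * (2 * m + 1)" using t by simp
        also have "\<dots> \<le> \<kappa> * \<delta>" using t m by (simp add: t0_def field_simps)
        also have "\<dots> \<le> \<kappa> * norm (y - ?y0)" using True \<kappa> by simp
        finally have 1: "t * (2 * m) \<le> \<kappa> * norm (y - ?y0)" .
        have "\<eta> ?y0 - \<epsilon> - \<eta> y \<le> 2 * m"
          using \<eta>(2)[of ?y0] \<eta>(2)[of y] \<epsilon> by linarith
        then have "t * (\<eta> ?y0 - \<epsilon> - \<eta> y) \<le> t * (2 * m)"
          using t by (intro mult_left_mono) auto
        with 1 \<kappa>(2)[OF True] show ?thesis by (simp add: algebra_simps)
      next
        case False
        then have "\<eta> ?y0 - \<epsilon> \<le> \<eta> y"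
          using \<delta>(2)[of y] unfolding dist_norm real_norm_def by linarith
        then have "t * (\<eta> ?y0 - \<epsilon>) \<le> t * \<eta> y" using t by (intro mult_left_mono) auto
        moreover have "\<psi> ?y0 - x \<bullet> ?y0 \<le> \<psi> y - x \<bullet> y"
          using tilt_map_in[OF x] by (simp add: tilt_argmin_def)
        ultimately show ?thesis by linarith
      qed
      then have "exp (\<psi> ?y0 - x \<bullet> ?y0 + t * (\<eta> ?y0 - \<epsilon>)) \<le> ?F t"
        by (intro expconj_greatest) auto
      then have "?E * exp (t * (\<eta> ?y0 - \<epsilon>)) \<le> ?F t" by (simp add: E exp_add)
      moreover have "?E * (1 + t * (\<eta> ?y0 - \<epsilon>)) \<le> ?E * exp (t * (\<eta> ?y0 - \<epsilon>))"
        using pos by (intro mult_left_mono exp_ge_add_one_self) auto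
      ultimately have "?E * (1 + t * (\<eta> ?y0 - \<epsilon>)) - ?E \<le> ?F t - ?E" by linarith
      then show ?thesis using t by (simp add: field_simps)
    qed
    then show ?thesis using t0 by (auto simp: eventually_at_right_field)
  qed
  have upper: "(?F t - ?E) / t \<le> ?E * ((exp (t * \<eta> ?y0) - 1) / t)" if t: "t > 0" for t
  proof -
    have "?F t \<le> exp (\<psi> ?y0 + t * \<eta> ?y0 - x \<bullet> ?y0)" by (rule expconj_le) simp
    also have "\<dots> = ?E * exp (t * \<eta> ?y0)" by (simp add: E exp_add[symmetric] algebra_simps)
    finally show ?thesis using t by (simp add: field_simps)
  qed
  have lim: "((\<lambda>t. ?E * ((exp (t * \<eta> ?y0) - 1) / t)) \<longlongrightarrow> ?E * \<eta> ?y0) (at_right 0)"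
    by (intro tendsto_mult tendsto_const exp_difference_quotient_tendsto)
  show ?thesis
  proof (rule order_tendstoI)
    fix a assume a: "a < ?E * \<eta> ?y0"
    \<comment> \<open>Chosen so that \<open>?E * \<epsilon>\<close> is half the distance from
      \<open>a\<close> to the limit, which leaves a strict inequality.\<close>
    define \<epsilon> where "\<epsilon> = (?E * \<eta> ?y0 - a) / (2 * ?E)"
    have "\<epsilon> > 0" using a pos by (simp add: \<epsilon>_def)
    have "?E * \<epsilon> = (?E * \<eta> ?y0 - a) / 2" using pos by (simp add: \<epsilon>_def)
    then have "a < ?E * (\<eta> ?y0 - \<epsilon>)" using a by (simp add: right_diff_distrib)
    with lower[OF \<open>\<epsilon> > 0\<close>] show "\<forall>\<^sub>F t in at_right 0. a < (?F t - ?E) / t"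
      by (auto elim: eventually_mono)
  next
    fix a assume "?E * \<eta> ?y0 < a"
    with lim have "\<forall>\<^sub>F t in at_right 0. ?E * ((exp (t * \<eta> ?y0) - 1) / t) < a"
      by (rule order_tendstoD)
    with eventually_at_right_less[of "0::real"] show "\<forall>\<^sub>F t in at_right 0. (?F t - ?E) / t < a"
      by eventually_elim (use upper in fastforce)
  qed
qed

end

section \<open>The variational problem\<close>

text \<open>The Lipschitz constant 1 matches the radius of the ball that carries the weight.\<close>

definition admissible :: "('a::euclidean_space \<Rightarrow> real) \<Rightarrow> bool" where
  "admissible \<psi> \<longleftrightarrow> (\<forall>x y. \<bar>\<psi> x - \<psi> y\<bar> \<le> norm (x - y)) \<and> (\<forall>x. \<psi> (- x) = \<psi> x)"

lemma admissible_continuous: "admissible \<psi> \<Longrightarrow> continuous_on UNIV \<psi>"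
  by (rule lipschitz_on_continuous_on[of 1])
     (auto intro!: lipschitz_onI simp: admissible_def dist_norm)

lemma admissible_norm: "admissible norm"
  by (simp add: admissible_def norm_triangle_ineq3)

lemma admissible_diff_const: "admissible \<psi> \<Longrightarrow> admissible (\<lambda>y. \<psi> y - c)"
  by (simp add: admissible_def)

text \<open>The inf-convolution with the norm is the largest 1-Lipschitz minorant; the conjugate of the
  norm is the indicator of the unit ball, so nothing is lost on the conjugate side inside the ball.\<close>

lemma admissible_minorant:
  fixes \<psi> \<rho> :: "'a::euclidean_space \<Rightarrow> real"
  assumes adm: "admissible \<psi>" and lower: "\<And>y. \<psi> y - m \<le> \<rho> y" and even: "\<And>y. \<rho> (- y) = \<rho> y"
  obtains \<psi>' where "admissible \<psi>'" "\<And>y. \<psi>' y \<le> \<rho> y"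
    "\<And>x. norm x \<le> 1 \<Longrightarrow> expconj UNIV \<rho> x \<le> expconj UNIV \<psi>' x"
proof -
  define g where "g y = (INF z. \<rho> z + norm (y - z))" for y
  have "\<psi> y - m \<le> \<rho> z + norm (y - z)" for y z
  proof -
    have "\<bar>\<psi> y - \<psi> z\<bar> \<le> norm (y - z)" using adm by (simp add: admissible_def)
    then show ?thesis using lower[of z] by linarith
  qed
  then have bdd: "bdd_below (range (\<lambda>z. \<rho> z + norm (y - z)))" for y
    by (intro bdd_belowI[of _ "\<psi> y - m"]) auto
  have g_le: "g y \<le> \<rho> z + norm (y - z)" for y z
    unfolding g_def by (rule cINF_lower[OF bdd]) simp
  have g_ge: "c \<le> g y" if "\<And>z. c \<le> \<rho> z + norm (y - z)" for c y
    unfolding g_def using that by (intro cINF_greatest) auto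
  have lip: "g x - norm (x - y) \<le> g y" for x y
  proof (rule g_ge)
    fix z
    have "norm (x - z) \<le> norm (x - y) + norm (y - z)"
      using norm_triangle_ineq[of "x - y" "y - z"] by simp
    then show "g x - norm (x - y) \<le> \<rho> z + norm (y - z)"
      using g_le[of x z] by linarith
  qed
  have neg: "g y \<le> g (- y)" for y
  proof (rule g_ge)
    fix z
    have "norm (y - - z) = norm (- y - z)"
      using norm_minus_cancel[of "y - - z"] by (simp add: algebra_simps)
    then show "g y \<le> \<rho> z + norm (- y - z)"
      using g_le[of y "- z"] even[of z] by simp
  qed
  show ?thesis
  proof (rule that[of g])
    show "admissible g"
      unfolding admissible_def
    proof (intro conjI allI)
      fix x y
      show "\<bar>g x - g y\<bar> \<le> norm (x - y)"
        using lip[of x y] lip[of y x] by (simp add: norm_minus_commute abs_le_iff)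
      show "g (- x) = g x" using neg[of x] neg[of "- x"] by simp
    qed
    show "g y \<le> \<rho> y" for y using g_le[of y y] by simp
    fix x :: 'a assume x: "norm x \<le> 1"
    show "expconj UNIV \<rho> x \<le> expconj UNIV g x"
    proof (cases "expconj UNIV \<rho> x = 0")
      case True
      then show ?thesis by (simp add: expconj_nonneg)
    next
      case False
      then have pos: "expconj UNIV \<rho> x > 0"
        using expconj_nonneg[of UNIV \<rho> x] by simp
      define l where "l = ln (expconj UNIV \<rho> x)"
      have l: "exp l = expconj UNIV \<rho> x" using pos by (simp add: l_def)
      have le: "l \<le> \<rho> z - x \<bullet> z" for z
        using expconj_le[of z UNIV \<rho> x] by (simp flip: l)
      \<comment> \<open>The affine minorant of \<open>\<rho>\<close> with slope \<open>x\<close> is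
        itself 1-Lipschitz because \<open>norm x \<le> 1\<close>, so it stays below the largest
        1-Lipschitz minorant.\<close>
      have "l + x \<bullet> y \<le> g y" for y
      proof (rule g_ge)
        fix z
        have "x \<bullet> (y - z) \<le> norm x * norm (y - z)" by (rule norm_cauchy_schwarz)
        also have "\<dots> \<le> norm (y - z)" using x by (intro mult_left_le_one_le) auto
        finally show "l + x \<bullet> y \<le> \<rho> z + norm (y - z)"
          using le[of z] by (simp add: inner_diff_right)
      qed
      then show ?thesis
        unfolding l[symmetric] by (intro expconj_greatest) (auto simp: algebra_simps)
    qed
  qed
qed

lemma tilt_argmin_uminus:
  assumes "\<And>x. \<psi> (- x) = \<psi> x" and "y \<in> tilt_argmin \<psi> x"
  shows "- y \<in> tilt_argmin \<psi> (- x)"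
  unfolding tilt_argmin_def
proof (intro CollectI allI)
  fix z
  have "\<psi> y - x \<bullet> y \<le> \<psi> (- z) - x \<bullet> (- z)"
    using assms(2) unfolding tilt_argmin_def by blast
  then show "\<psi> (- y) - (- x) \<bullet> (- y) \<le> \<psi> z - (- x) \<bullet> z" by (simp add: assms(1))
qed

lemma tilt_map_uminus:
  fixes \<psi> :: "'a::euclidean_space \<Rightarrow> real"
  assumes even: "\<And>x. \<psi> (- x) = \<psi> x"
  shows "tilt_map \<psi> (- x) = - tilt_map \<psi> x"
proof -
  have argmin: "y \<in> tilt_argmin \<psi> (- x) \<longleftrightarrow> - y \<in> tilt_argmin \<psi> x" for x y
    using tilt_argmin_uminus[where \<psi> = \<psi>, OF even, of y "- x"]
      tilt_argmin_uminus[where \<psi> = \<psi>, OF even, of "- y" x] by auto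
  have E: "expconj UNIV \<psi> (- x) = expconj UNIV \<psi> x" for x
    by (rule expconj_uminus) (rule even)
  have "uminus ` {x. expconj UNIV \<psi> x > 0} = {x. expconj UNIV \<psi> x > 0}"
  proof (intro equalityI subsetI)
    fix x assume "x \<in> {x. expconj UNIV \<psi> x > 0}"
    then show "x \<in> uminus ` {x. expconj UNIV \<psi> x > 0}"
      by (intro image_eqI[of _ _ "- x"]) (auto simp: E)
  qed (auto simp: E)
  then have "uminus ` expconj_dom \<psi> = expconj_dom \<psi>"
    unfolding expconj_dom_def using interior_negations[of "{x. expconj UNIV \<psi> x > 0}"] by simp
  then have dom: "- x \<in> expconj_dom \<psi> \<longleftrightarrow> x \<in> expconj_dom \<psi>" for x
    by (metis image_eqI minus_minus)
  have uni: "- x \<in> unique_argmin \<psi>" if "x \<in> unique_argmin \<psi>" for x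
  proof -
    obtain y where y: "y \<in> tilt_argmin \<psi> x" "\<And>z. z \<in> tilt_argmin \<psi> x \<Longrightarrow> z = y"
      using \<open>x \<in> unique_argmin \<psi>\<close> by (auto simp: unique_argmin_def)
    have "\<exists>!z. z \<in> tilt_argmin \<psi> (- x)"
    proof (rule ex1I[of _ "- y"])
      show "- y \<in> tilt_argmin \<psi> (- x)" using y(1) by (simp add: argmin)
      fix z assume "z \<in> tilt_argmin \<psi> (- x)"
      then have "- z = y" by (intro y(2)) (simp add: argmin)
      then show "z = - y" by auto
    qed
    then show ?thesis using \<open>x \<in> unique_argmin \<psi>\<close> by (simp add: unique_argmin_def dom)
  qed
  show ?thesis
  proof (cases "x \<in> unique_argmin \<psi>")
    case True
    show ?thesis
      by (rule tilt_map_eq[OF uni[OF True]]) (simp add: argmin tilt_map_in[OF True])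
  next
    case False
    then have "- x \<notin> unique_argmin \<psi>" using uni[of "- x"] by auto
    with False show ?thesis by (simp add: tilt_map_def)
  qed
qed

lemma even_measure_distr_uminus:
  fixes \<mu> :: "'a::real_normed_vector measure"
  assumes sets: "sets \<mu> = sets borel" and even: "even_measure \<mu>"
  shows "distr \<mu> borel uminus = \<mu>"
proof (rule measure_eqI)
  note sets [measurable_cong]
  fix B assume "B \<in> sets (distr \<mu> borel uminus)"
  then have B: "B \<in> sets borel" by simp
  have "emeasure (distr \<mu> borel uminus) B = emeasure \<mu> (uminus -` B \<inter> space \<mu>)"
  proof (rule emeasure_distr[OF _ B])
    show "uminus \<in> borel_measurable \<mu>"
      unfolding measurable_cong_sets[OF sets refl]
      by (intro borel_measurable_continuous_onI continuous_intros)
  qed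
  also have "uminus -` B \<inter> space \<mu> = uminus ` B"
    using sets_eq_imp_space_eq[OF sets] by (auto simp: image_iff) (metis minus_minus)
  also have "emeasure \<mu> (uminus ` B) = emeasure \<mu> B"
    using even B by (simp add: even_measure_def)
  finally show "emeasure (distr \<mu> borel uminus) B = emeasure \<mu> B" .
qed (simp add: sets)

text \<open>The weight stands for the power of the norm cut off at the unit ball. Its positive
  integral makes the supremum of the functional positive, and the first moment of
  \<open>\<mu>\<close> makes Lipschitz functions integrable.\<close>

locale weighted_moment_problem =
  fixes \<omega> :: "'a::euclidean_space \<Rightarrow> real" and \<mu> :: "'a measure"
  assumes weight_integrable: "integrable lborel \<omega>"
    and weight_nonneg: "0 \<le> \<omega> x"
    and weight_even: "\<omega> (- x) = \<omega> x"
    and weight_support: "norm x > 1 \<Longrightarrow> \<omega> x = 0"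
    and weight_positive: "0 < (\<integral>x. \<omega> x \<partial>lborel)"
    and sets_target: "sets \<mu> = sets borel"
    and finite_target: "finite_measure \<mu>"
    and nonzero_target: "emeasure \<mu> UNIV \<noteq> 0"
    and even_target: "even_measure \<mu>"
    and moment_target: "integrable \<mu> norm"
begin

sublocale finite_measure \<mu> by (rule finite_target)

declare sets_target [measurable_cong]

lemma space_target [simp]: "space \<mu> = UNIV"
  using sets_eq_imp_space_eq[OF sets_target] by simp

lemma measure_target_pos: "measure \<mu> UNIV > 0"
  using nonzero_target by (simp add: emeasure_eq_measure zero_less_measure_iff)

lemma borel_measurable_weight [measurable]: "\<omega> \<in> borel_measurable borel"
  using borel_measurable_integrable[OF weight_integrable] by simp

definition mass :: "('a \<Rightarrow> real) \<Rightarrow> real" where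
  "mass \<psi> = (\<integral>x. expconj UNIV \<psi> x * \<omega> x \<partial>lborel)"

definition average :: "('a \<Rightarrow> real) \<Rightarrow> real" where
  "average \<psi> = (\<integral>y. \<psi> y \<partial>\<mu>) / measure \<mu> UNIV"

text \<open>The multiplicative form avoids a logarithm of \<open>mass \<psi>\<close>, which is 0 for
  admissible functions such as the negative of the norm.\<close>

definition score :: "('a \<Rightarrow> real) \<Rightarrow> real" where
  "score \<psi> = mass \<psi> * exp (- average \<psi>)"

lemma mass_integrable: "integrable lborel (\<lambda>x. expconj UNIV \<psi> x * \<omega> x)"
proof (rule Bochner_Integration.integrable_bound)
  show "integrable lborel (\<lambda>x. exp (\<psi> 0) * \<omega> x)"
    using weight_integrable by simp
  show "(\<lambda>x. expconj UNIV \<psi> x * \<omega> x) \<in> borel_measurable lborel"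
    by (intro borel_measurable_times) (auto intro: borel_measurable_expconj)
  show "AE x in lborel. norm (expconj UNIV \<psi> x * \<omega> x) \<le> norm (exp (\<psi> 0) * \<omega> x)"
    using expconj_le[of 0 UNIV \<psi>] weight_nonneg
    by (auto simp: abs_mult expconj_nonneg intro!: mult_right_mono)
qed

text \<open>A comparison on the unit ball suffices since the weight vanishes outside; passing to a
  1-Lipschitz minorant gives no more than that.\<close>

lemma mass_mono:
  assumes "\<And>x. norm x \<le> 1 \<Longrightarrow> expconj UNIV \<psi> x \<le> expconj UNIV \<psi>' x"
  shows "mass \<psi> \<le> mass \<psi>'"
  unfolding mass_def
proof (intro integral_mono mass_integrable)
  fix x show "expconj UNIV \<psi> x * \<omega> x \<le> expconj UNIV \<psi>' x * \<omega> x"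
    using assms[of x] weight_nonneg[of x] weight_support[of x]
    by (cases "norm x \<le> 1") (auto intro: mult_right_mono)
qed

lemma mass_nonneg: "mass \<psi> \<ge> 0"
  unfolding mass_def
  by (intro integral_nonneg_AE AE_I2 mult_nonneg_nonneg expconj_nonneg weight_nonneg) simp

lemma admissible_integrable:
  assumes "admissible \<psi>"
  shows "integrable \<mu> \<psi>"
proof (rule Bochner_Integration.integrable_bound)
  show "integrable \<mu> (\<lambda>y. \<bar>\<psi> 0\<bar> + norm y)"
    using moment_target by simp
  have "\<psi> \<in> borel_measurable borel"
    by (rule borel_measurable_continuous_onI[OF admissible_continuous[OF assms]])
  then show "\<psi> \<in> borel_measurable \<mu>" by measurable
  have "\<bar>\<psi> y - \<psi> 0\<bar> \<le> norm y" for y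
    using assms unfolding admissible_def by (metis diff_zero)
  then have "\<bar>\<psi> y\<bar> \<le> \<bar>\<psi> 0\<bar> + norm y" for y by (smt (verit))
  then show "AE y in \<mu>. norm (\<psi> y) \<le> norm (\<bar>\<psi> 0\<bar> + norm y)"
    by (intro AE_I2) (simp add: order_trans[OF _ abs_ge_self])
qed

lemma average_diff_const:
  assumes "admissible \<psi>"
  shows "average (\<lambda>y. \<psi> y - c) = average \<psi> - c"
  using admissible_integrable[OF assms] measure_target_pos
  by (simp add: average_def diff_divide_distrib)

lemma average_mono:
  assumes "integrable \<mu> f" "integrable \<mu> g" "\<And>y. f y \<le> g y"
  shows "average f \<le> average g"
  unfolding average_def using measure_target_pos assms
  by (intro divide_right_mono integral_mono) auto

lemma score_diff_const:
  assumes "admissible \<psi>"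
  shows "score (\<lambda>y. \<psi> y - c) = score \<psi>"
proof -
  have "mass (\<lambda>y. \<psi> y - c) = exp (- c) * mass \<psi>"
    by (simp add: mass_def expconj_diff_const mult.assoc)
  then show ?thesis
    by (simp add: score_def average_diff_const[OF assms] exp_diff exp_minus field_simps)
qed

lemma mass_le:
  assumes "\<psi> 0 = 0"
  shows "mass \<psi> \<le> (\<integral>x. \<omega> x \<partial>lborel)"
  unfolding mass_def
  by (intro integral_mono mass_integrable weight_integrable mult_left_le_one_le expconj_nonneg
      expconj_le_1 assms weight_nonneg) simp

text \<open>The normalisation at 0 bounds both factors: the infimum tested at 0 is at most 1, and
  \<open>\<psi>\<close> is at least minus the norm, whose average is finite.\<close>

lemma score_le:
  assumes "admissible \<psi>" "\<psi> 0 = 0"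
  shows "score \<psi> \<le> (\<integral>x. \<omega> x \<partial>lborel) * exp (average norm)"
  unfolding score_def
proof (intro mult_mono mass_le assms)
  have "\<bar>\<psi> y - \<psi> 0\<bar> \<le> norm y" for y
    using assms unfolding admissible_def by (metis diff_zero)
  then have "- \<psi> y \<le> norm y" for y using assms(2) by (smt (verit))
  then have "average (\<lambda>y. - \<psi> y) \<le> average norm"
    by (intro average_mono) (auto intro: admissible_integrable assms moment_target)
  then show "exp (- average \<psi>) \<le> exp (average norm)"
    by (simp add: average_def)
qed (use weight_positive in auto)

text \<open>The conjugate of the norm is 0 on the unit ball, so the mass is at least the integral of
  the weight. This competitor forces a maximiser to have positive mass.\<close>

lemma score_norm_pos: "score norm > 0"
proof -
  have "1 \<le> expconj UNIV norm x" if "norm x \<le> 1" for x :: 'a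
  proof (rule expconj_greatest)
    fix y
    have "x \<bullet> y \<le> norm x * norm y" by (rule norm_cauchy_schwarz)
    also have "\<dots> \<le> norm y" using that by (intro mult_left_le_one_le) auto
    finally show "1 \<le> exp (norm y - x \<bullet> y)" by simp
  qed simp
  then have "\<omega> x \<le> expconj UNIV norm x * \<omega> x" for x
    using weight_nonneg[of x] weight_support[of x]
    by (cases "norm x \<le> 1") (use mult_right_mono[of 1 "expconj UNIV norm x" "\<omega> x"] in auto)
  then have "(\<integral>x. \<omega> x \<partial>lborel) \<le> mass norm"
    unfolding mass_def by (intro integral_mono weight_integrable mass_integrable)
  then show ?thesis using weight_positive by (simp add: score_def)
qed

text \<open>Only the inequality \<open>limsup (mass (f n)) \<le> mass g\<close> holds in general; it is the one needed.\<close>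

lemma mass_limit:
  assumes zero: "\<And>n. f n 0 = 0" and lim: "\<And>y. (\<lambda>n. f n y) \<longlonglongrightarrow> g y"
    and L: "(\<lambda>n. mass (f n)) \<longlonglongrightarrow> L"
  shows "L \<le> mass g"
proof -
  let ?u = "\<lambda>n x. ennreal (expconj UNIV (f n) x * \<omega> x)"
  have L0: "L \<ge> 0" by (rule LIMSEQ_le_const[OF L]) (auto simp: mass_nonneg)
  have nn: "(\<integral>\<^sup>+ x. ennreal (expconj UNIV \<psi> x * \<omega> x) \<partial>lborel) = ennreal (mass \<psi>)" for \<psi>
    unfolding mass_def
    by (intro nn_integral_eq_integral mass_integrable AE_I2 mult_nonneg_nonneg expconj_nonneg weight_nonneg) simp
  have [measurable]: "expconj UNIV \<psi> \<in> borel_measurable borel" for \<psi> :: "'a \<Rightarrow> real"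
    by (rule borel_measurable_expconj) simp
  have "(\<lambda>n. \<integral>\<^sup>+ x. ?u n x \<partial>lborel) \<longlonglongrightarrow> ennreal L"
    unfolding nn using L by (rule tendsto_ennrealI)
  then have "ennreal L = limsup (\<lambda>n. \<integral>\<^sup>+ x. ?u n x \<partial>lborel)"
    by (simp add: lim_imp_Limsup)
  \<comment> \<open>Reverse Fatou; the normalisation at 0 lets the weight serve as the dominating
    function.\<close>
  also have "\<dots> \<le> (\<integral>\<^sup>+ x. limsup (\<lambda>n. ?u n x) \<partial>lborel)"
  proof (rule nn_integral_limsup[where w = "\<lambda>x. ennreal (\<omega> x)"])
    show "AE x in lborel. ?u n x \<le> ennreal (\<omega> x)" for n
      by (intro AE_I2 ennreal_leI mult_left_le_one_le expconj_nonneg expconj_le_1 zero weight_nonneg) simp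
    show "(\<integral>\<^sup>+ x. ennreal (\<omega> x) \<partial>lborel) < \<infinity>"
      using nn_integral_eq_integral[OF weight_integrable] weight_nonneg by simp
  qed measurable
  also have "\<dots> \<le> (\<integral>\<^sup>+ x. ennreal (expconj UNIV g x * \<omega> x) \<partial>lborel)"
  proof (rule nn_integral_mono)
    fix x
    \<comment> \<open>The limit is taken with one test point \<open>y\<close> fixed, and the infimum
      over \<open>y\<close> only afterwards; this order of operations gives just one
      inequality.\<close>
    have le: "limsup (\<lambda>n. ?u n x) \<le> ennreal (exp (g y - x \<bullet> y) * \<omega> x)" for y
    proof -
      have "limsup (\<lambda>n. ?u n x) \<le> limsup (\<lambda>n. ennreal (exp (f n y - x \<bullet> y) * \<omega> x))"
        by (intro Limsup_mono always_eventually allI ennreal_leI mult_right_mono expconj_le weight_nonneg) simp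
      also have "\<dots> = ennreal (exp (g y - x \<bullet> y) * \<omega> x)"
        by (intro lim_imp_Limsup tendsto_ennrealI tendsto_intros lim) simp
      finally show ?thesis .
    qed
    show "limsup (\<lambda>n. ?u n x) \<le> ennreal (expconj UNIV g x * \<omega> x)"
    proof (cases "\<omega> x = 0")
      case True
      then show ?thesis using le[of 0] by simp
    next
      case False
      then have w: "\<omega> x > 0" using weight_nonneg[of x] by simp
      obtain l where l: "limsup (\<lambda>n. ?u n x) = ennreal l" "l \<ge> 0"
        using le[of 0] by (metis ennreal_cases ennreal_neq_top top.extremum_unique)
      have "l / \<omega> x \<le> expconj UNIV g x"
      proof (rule expconj_greatest)
        fix y
        have "l \<le> exp (g y - x \<bullet> y) * \<omega> x"
          using le[of y] w unfolding l(1) by (simp add: ennreal_le_iff)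
        then show "l / \<omega> x \<le> exp (g y - x \<bullet> y)" using w by (simp add: divide_le_eq)
      qed simp
      then show ?thesis using w unfolding l(1) by (intro ennreal_leI) (simp add: divide_le_eq)
    qed
  qed
  finally show ?thesis
    unfolding nn using mass_nonneg[of g] by (simp add: ennreal_le_iff)
qed

section \<open>Existence of a maximiser\<close>

lemma score_maximiser:
  obtains \<psi> where "admissible \<psi>" "mass \<psi> > 0" "\<And>\<psi>'. admissible \<psi>' \<Longrightarrow> score \<psi>' \<le> score \<psi>"
proof -
  \<comment> \<open>Invariance under constants permits the normalisation at 0, which supplies both
    the upper bound and the compactness.\<close>
  define A where "A = {\<psi> :: 'a \<Rightarrow> real. admissible \<psi> \<and> \<psi> 0 = 0}"
  define S where "S = Sup (score ` A)"
  have norm_A: "norm \<in> A" by (simp add: A_def admissible_norm)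
  have bdd: "bdd_above (score ` A)"
    by (rule bdd_aboveI) (auto simp: A_def intro: score_le)
  have S_ge: "score \<psi> \<le> S" if "\<psi> \<in> A" for \<psi>
    unfolding S_def by (rule cSUP_upper[OF that bdd])
  have S_pos: "S > 0" using S_ge[OF norm_A] score_norm_pos by linarith
  have "\<exists>\<psi>\<in>A. S - inverse (real (Suc n)) < score \<psi>" for n
  proof -
    have "S - inverse (real (Suc n)) < S" by simp
    then show ?thesis
      unfolding S_def using less_cSUP_iff[OF _ bdd] norm_A by blast
  qed
  then obtain f where f: "\<And>n. f n \<in> A" "\<And>n. S - inverse (real (Suc n)) < score (f n)"
    by metis
  have score_lim: "(\<lambda>n. score (f n)) \<longlonglongrightarrow> S"
  proof (rule tendsto_sandwich[OF _ _ _ tendsto_const])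
    show "(\<lambda>n. S - inverse (real (Suc n))) \<longlonglongrightarrow> S"
      using tendsto_diff[OF tendsto_const LIMSEQ_inverse_real_of_nat, of S] by simp
  qed (use f S_ge in \<open>auto intro: always_eventually less_imp_le\<close>)
  have adm: "admissible (f n)" and zero: "f n 0 = 0" for n
    using f(1)[of n] by (auto simp: A_def)
  have lip: "\<bar>f n x - f n y\<bar> \<le> norm (x - y)" for n x y
    using adm[of n] by (simp add: admissible_def)
  obtain k g where k: "strict_mono k" and g: "\<And>x. (\<lambda>n. f (k n) x) \<longlonglongrightarrow> g x"
    using lipschitz_convergent_subsequence[of f, OF lip zero] by blast
  have "\<bar>g x - g y\<bar> \<le> norm (x - y)" for x y
    by (rule LIMSEQ_le_const2[OF tendsto_rabs[OF tendsto_diff[OF g g]]]) (use lip in auto)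
  moreover have "g (- x) = g x" for x
  proof -
    have "(\<lambda>n. f (k n) (- x)) = (\<lambda>n. f (k n) x)"
      using adm by (simp add: admissible_def)
    then show ?thesis using g[of x] g[of "- x"] LIMSEQ_unique by metis
  qed
  ultimately have adm_g: "admissible g" by (simp add: admissible_def)
  have "(\<lambda>n. \<integral>y. f (k n) y \<partial>\<mu>) \<longlonglongrightarrow> (\<integral>y. g y \<partial>\<mu>)"
  proof (rule integral_dominated_convergence[where w = norm])
    show "AE y in \<mu>. norm (f (k n) y) \<le> norm y" for n
      using lip[of "k n" y 0 for y] zero[of "k n"] by simp
  qed (use g moment_target borel_measurable_integrable[OF admissible_integrable] adm adm_g in auto)
  then have avg: "(\<lambda>n. average (f (k n))) \<longlonglongrightarrow> average g"
    unfolding average_def using measure_target_pos by (intro tendsto_divide tendsto_const) auto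
  \<comment> \<open>Scores converge by maximality and averages by domination with the norm; the
    masses then converge as their combination, which is what \<open>mass_limit\<close>
    requires.\<close>
  have "(\<lambda>n. score (f (k n)) * exp (average (f (k n)))) \<longlonglongrightarrow> S * exp (average g)"
    using LIMSEQ_subseq_LIMSEQ[OF score_lim k] avg
    by (intro tendsto_mult tendsto_exp) (auto simp: comp_def)
  then have "(\<lambda>n. mass (f (k n))) \<longlonglongrightarrow> S * exp (average g)"
    by (simp add: score_def mult.assoc flip: exp_add)
  then have mass_g: "S * exp (average g) \<le> mass g"
    by (intro mass_limit[of "\<lambda>n. f (k n)" g] zero g)
  show ?thesis
  proof (rule that[OF adm_g])
    have "0 < S * exp (average g)" using S_pos by simp
    then show "mass g > 0" using mass_g by linarith
    fix \<psi> :: "'a \<Rightarrow> real" assume \<psi>: "admissible \<psi>"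
    have "score \<psi> = score (\<lambda>y. \<psi> y - \<psi> 0)" by (rule score_diff_const[OF \<psi>, symmetric])
    also have "\<dots> \<le> S" by (rule S_ge) (simp add: A_def admissible_diff_const[OF \<psi>])
    also have "S \<le> score g" using mass_g by (simp add: score_def exp_minus field_simps)
    finally show "score \<psi> \<le> score g" .
  qed
qed

section \<open>The Euler-Lagrange equation\<close>

lemma mass_perturb_le:
  assumes \<psi>: "admissible \<psi>" and max: "\<And>\<psi>'. admissible \<psi>' \<Longrightarrow> score \<psi>' \<le> score \<psi>"
    and \<eta>: "continuous_on UNIV \<eta>" "\<And>y. \<bar>\<eta> y\<bar> \<le> m" "\<And>y. \<eta> (- y) = \<eta> y" and t: "t \<ge> 0"
  shows "mass (\<lambda>y. \<psi> y + t * \<eta> y) \<le> mass \<psi> * exp (t * average \<eta>)"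
proof -
  \<comment> \<open>This lower bound keeps finite the infimum that defines the Lipschitz
    minorant.\<close>
  have "\<psi> y - t * m \<le> \<psi> y + t * \<eta> y" for y
    using mult_left_mono[of "- m" "\<eta> y" t] \<eta>(2)[of y] t by simp
  moreover have "\<psi> (- y) + t * \<eta> (- y) = \<psi> y + t * \<eta> y" for y
    using \<psi> \<eta>(3) by (simp add: admissible_def)
  ultimately obtain \<psi>' where \<psi>': "admissible \<psi>'" "\<And>y. \<psi>' y \<le> \<psi> y + t * \<eta> y"
    "\<And>x. norm x \<le> 1 \<Longrightarrow> expconj UNIV (\<lambda>y. \<psi> y + t * \<eta> y) x \<le> expconj UNIV \<psi>' x"
    using admissible_minorant[OF \<psi>, of "t * m" "\<lambda>y. \<psi> y + t * \<eta> y"] by blast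
  have "\<eta> \<in> borel_measurable borel" by (rule borel_measurable_continuous_onI[OF \<eta>(1)])
  then have \<eta>_int: "integrable \<mu> \<eta>"
    by (intro integrable_const_bound[where B = m]) (auto simp: \<eta>(2))
  have "average \<psi>' \<le> average (\<lambda>y. \<psi> y + t * \<eta> y)"
    by (intro average_mono \<psi>'(2) Bochner_Integration.integrable_add admissible_integrable \<psi> \<psi>'(1)
        integrable_mult_right \<eta>_int)
  also have "\<dots> = average \<psi> + t * average \<eta>"
    using \<eta>_int admissible_integrable[OF \<psi>] by (simp add: average_def add_divide_distrib)
  finally have avg: "average \<psi>' - average \<psi> \<le> t * average \<eta>" by simp
  have "mass (\<lambda>y. \<psi> y + t * \<eta> y) \<le> mass \<psi>'" by (intro mass_mono \<psi>'(3))
  also have "\<dots> = score \<psi>' * exp (average \<psi>')"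
    by (simp add: score_def mult.assoc flip: exp_add)
  also have "\<dots> \<le> score \<psi> * exp (average \<psi>')"
    by (intro mult_right_mono max \<psi>'(1)) simp
  also have "\<dots> = mass \<psi> * exp (average \<psi>' - average \<psi>)"
    by (simp add: score_def mult.assoc flip: exp_add)
  also have "\<dots> \<le> mass \<psi> * exp (t * average \<eta>)"
    using avg mass_nonneg by (intro mult_left_mono) auto
  finally show ?thesis .
qed

text \<open>Both sides of \<open>mass_perturb_le\<close> agree at \<open>t = 0\<close>, so the
  inequality survives subtracting \<open>mass \<psi>\<close>, dividing by \<open>t\<close> and
  letting \<open>t\<close> decrease to 0.\<close>

lemma euler_lagrange_le:
  assumes \<psi>: "admissible \<psi>" and max: "\<And>\<psi>'. admissible \<psi>' \<Longrightarrow> score \<psi>' \<le> score \<psi>"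
    and \<eta>: "continuous_on UNIV \<eta>" "\<And>y. \<bar>\<eta> y\<bar> \<le> m" "\<And>y. \<eta> (- y) = \<eta> y"
  shows "(\<integral>x. \<eta> (tilt_map \<psi> x) * (expconj UNIV \<psi> x * \<omega> x) \<partial>lborel) \<le> mass \<psi> * average \<eta>"
proof -
  note cont = admissible_continuous[OF \<psi>]
  define t where "t n = inverse (real (Suc n))" for n
  have t: "t n > 0" "t n \<le> 1" for n by (auto simp: t_def divide_simps)
  have t_lim: "filterlim t (at_right 0) sequentially"
  proof -
    have "t \<longlonglongrightarrow> 0" unfolding t_def by (rule LIMSEQ_inverse_real_of_nat)
    then show ?thesis using t(1) by (simp add: filterlim_at less_imp_neq[symmetric])
  qed
  let ?Q = "\<lambda>n x. (expconj UNIV (\<lambda>y. \<psi> y + t n * \<eta> y) x - expconj UNIV \<psi> x) / t n"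
  have [measurable]: "expconj UNIV \<psi> \<in> borel_measurable borel" for \<psi> :: "'a \<Rightarrow> real"
    by (rule borel_measurable_expconj) simp
  have [measurable]: "tilt_map \<psi> \<in> borel_measurable borel"
    by (rule borel_measurable_tilt_map[OF cont])
  have [measurable]: "\<eta> \<in> borel_measurable borel"
    by (rule borel_measurable_continuous_onI[OF \<eta>(1)])
  have "(\<lambda>n. \<integral>x. ?Q n x * \<omega> x \<partial>lborel) \<longlonglongrightarrow>
        (\<integral>x. \<eta> (tilt_map \<psi> x) * (expconj UNIV \<psi> x * \<omega> x) \<partial>lborel)"
  proof (rule integral_dominated_convergence[where w = "\<lambda>x. exp (\<psi> 0) * (m * exp m) * \<omega> x"])
    show "integrable lborel (\<lambda>x. exp (\<psi> 0) * (m * exp m) * \<omega> x)"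
      using weight_integrable by simp
    show "AE x in lborel. (\<lambda>n. ?Q n x * \<omega> x) \<longlonglongrightarrow> \<eta> (tilt_map \<psi> x) * (expconj UNIV \<psi> x * \<omega> x)"
      using AE_unique_argmin[OF cont]
    proof eventually_elim
      case (elim x)
      have "(\<lambda>n. ?Q n x) \<longlonglongrightarrow> expconj UNIV \<psi> x * \<eta> (tilt_map \<psi> x)"
      proof (cases "expconj UNIV \<psi> x > 0")
        case True
        with elim have "x \<in> unique_argmin \<psi>" by simp
        from filterlim_compose[OF expconj_perturb_tendsto[OF cont this \<eta>(1,2)] t_lim]
        show ?thesis .
      next
        case False
        then have E: "expconj UNIV \<psi> x = 0" using expconj_nonneg[of UNIV \<psi> x] by simp
        \<comment> \<open>A bounded perturbation changes the infimum by at most a bounded factor, so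
          a zero stays a zero and the difference quotient vanishes.\<close>
        have "expconj UNIV (\<lambda>y. \<psi> y + t n * \<eta> y) x \<le> exp (t n * m) * expconj UNIV \<psi> x" for n
        proof (rule expconj_perturb_le)
          show "\<psi> y + t n * \<eta> y \<le> \<psi> y + t n * m" for y
            using mult_left_mono[of "\<eta> y" m "t n"] \<eta>(2)[of y] t[of n] by simp
        qed
        then have "expconj UNIV (\<lambda>y. \<psi> y + t n * \<eta> y) x = 0" for n
          using expconj_nonneg[of UNIV "\<lambda>y. \<psi> y + t n * \<eta> y" x] E by (simp add: antisym)
        then show ?thesis by (simp add: E)
      qed
      then have "(\<lambda>n. ?Q n x * \<omega> x) \<longlonglongrightarrow> expconj UNIV \<psi> x * \<eta> (tilt_map \<psi> x) * \<omega> x"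
        by (intro tendsto_mult tendsto_const)
      then show ?case by (simp add: mult_ac)
    qed
    show "AE x in lborel. norm (?Q n x * \<omega> x) \<le> exp (\<psi> 0) * (m * exp m) * \<omega> x" for n
      using expconj_difference_quotient_bound[of \<eta> m "t n" \<psi>, OF \<eta>(2) t] weight_nonneg
      by (intro AE_I2) (simp only: real_norm_def abs_mult abs_of_nonneg mult_right_mono)
  qed measurable
  moreover have "(\<integral>x. ?Q n x * \<omega> x \<partial>lborel) \<le> mass \<psi> * ((exp (t n * average \<eta>) - 1) / t n)" for n
  proof -
    have "(\<integral>x. ?Q n x * \<omega> x \<partial>lborel)
        = (\<integral>x. (expconj UNIV (\<lambda>y. \<psi> y + t n * \<eta> y) x * \<omega> x - expconj UNIV \<psi> x * \<omega> x) / t n \<partial>lborel)"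
      by (simp add: algebra_simps diff_divide_distrib)
    also have "\<dots> = (mass (\<lambda>y. \<psi> y + t n * \<eta> y) - mass \<psi>) / t n"
      unfolding mass_def by (simp add: mass_integrable)
    also have "\<dots> \<le> (mass \<psi> * exp (t n * average \<eta>) - mass \<psi>) / t n"
      using mass_perturb_le[OF \<psi> max \<eta>, of "t n"] t[of n]
      by (intro divide_right_mono) auto
    finally show ?thesis by (simp add: algebra_simps)
  qed
  moreover have "(\<lambda>n. mass \<psi> * ((exp (t n * average \<eta>) - 1) / t n)) \<longlonglongrightarrow> mass \<psi> * average \<eta>"
    by (intro tendsto_mult tendsto_const filterlim_compose[OF exp_difference_quotient_tendsto t_lim])
  ultimately show ?thesis by (intro LIMSEQ_le) auto
qed

lemma euler_lagrange:
  assumes \<psi>: "admissible \<psi>" and max: "\<And>\<psi>'. admissible \<psi>' \<Longrightarrow> score \<psi>' \<le> score \<psi>"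
    and \<eta>: "continuous_on UNIV \<eta>" "\<And>y. \<bar>\<eta> y\<bar> \<le> m" "\<And>y. \<eta> (- y) = \<eta> y"
  shows "(\<integral>x. \<eta> (tilt_map \<psi> x) * (expconj UNIV \<psi> x * \<omega> x) \<partial>lborel) = mass \<psi> * average \<eta>"
proof (rule antisym)
  \<comment> \<open>The class of test functions is closed under negation, which turns the one-sided
    inequality into an equality.\<close>
  have "(\<integral>x. - \<eta> (tilt_map \<psi> x) * (expconj UNIV \<psi> x * \<omega> x) \<partial>lborel) \<le> mass \<psi> * average (\<lambda>y. - \<eta> y)"
    using \<eta> by (intro euler_lagrange_le[OF \<psi> max] continuous_intros) auto
  then show "mass \<psi> * average \<eta> \<le> (\<integral>x. \<eta> (tilt_map \<psi> x) * (expconj UNIV \<psi> x * \<omega> x) \<partial>lborel)"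
    by (simp add: average_def)
qed (rule euler_lagrange_le[OF \<psi> max \<eta>])

lemma integral_even_part_target:
  fixes f :: "'a \<Rightarrow> real"
  assumes "continuous_on UNIV f" "\<And>y. \<bar>f y\<bar> \<le> m"
  shows "(\<integral>y. (f y + f (- y)) / 2 \<partial>\<mu>) = (\<integral>y. f y \<partial>\<mu>)"
proof -
  have [measurable]: "f \<in> borel_measurable borel"
    by (rule borel_measurable_continuous_onI[OF assms(1)])
  have int: "integrable \<mu> f" "integrable \<mu> (\<lambda>y. f (- y))"
    using assms(2) by (auto intro!: integrable_const_bound[where B = m])
  have "(\<integral>y. f y \<partial>\<mu>) = (\<integral>y. f y \<partial>distr \<mu> borel uminus)"
    by (simp add: even_measure_distr_uminus[OF sets_target even_target])
  also have "\<dots> = (\<integral>y. f (- y) \<partial>\<mu>)"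
    by (rule integral_distr) measurable
  finally show ?thesis using int by simp
qed

text \<open>The Euler-Lagrange equation sees only even test functions, but both measures are even.\<close>

lemma distr_tilt_map_eq_target:
  assumes \<psi>: "admissible \<psi>" and pos: "mass \<psi> > 0"
    and max: "\<And>\<psi>'. admissible \<psi>' \<Longrightarrow> score \<psi>' \<le> score \<psi>"
  shows "distr (density lborel (\<lambda>x. ennreal (measure \<mu> UNIV / mass \<psi> * (expconj UNIV \<psi> x * \<omega> x))))
           borel (tilt_map \<psi>) = \<mu>"
proof (rule measure_eqI_bounded_continuous)
  \<comment> \<open>The factor that gives the pushforward the total mass of \<open>\<mu>\<close>, as
    the constant test function 1 shows.\<close>
  define c where "c = measure \<mu> UNIV / mass \<psi>"
  have c: "c > 0" using pos measure_target_pos by (simp add: c_def)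
  let ?h = "\<lambda>x. expconj UNIV \<psi> x * \<omega> x"
  let ?D = "density lborel (\<lambda>x. ennreal (c * ?h x))"
  let ?\<nu> = "distr ?D borel (tilt_map \<psi>)"
  have even: "\<psi> (- y) = \<psi> y" for y using \<psi> by (simp add: admissible_def)
  have [measurable]: "expconj UNIV \<psi> \<in> borel_measurable borel"
    by (rule borel_measurable_expconj) simp
  have [measurable]: "tilt_map \<psi> \<in> borel_measurable borel"
    by (rule borel_measurable_tilt_map[OF admissible_continuous[OF \<psi>]])
  have h: "0 \<le> c * ?h x" for x
    using c by (intro mult_nonneg_nonneg expconj_nonneg weight_nonneg) auto
  have h_even: "?h (- x) = ?h x" for x
    by (simp add: expconj_uminus[of \<psi>, OF even] weight_even)
  show "sets ?\<nu> = sets borel" "sets \<mu> = sets borel" "finite_measure \<mu>"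
    by (simp_all add: sets_target finite_target)
  show "finite_measure ?\<nu>"
  proof (intro finite_measure.finite_measure_distr finite_measureI)
    have "emeasure ?D (space ?D) = (\<integral>\<^sup>+ x. ennreal (c * ?h x) \<partial>lborel)"
      by (simp add: emeasure_density)
    also have "\<dots> = ennreal (\<integral>x. c * ?h x \<partial>lborel)"
      using h by (intro nn_integral_eq_integral integrable_mult_right mass_integrable) auto
    finally show "emeasure ?D (space ?D) \<noteq> \<infinity>" by simp
  qed measurable
  fix f :: "'a \<Rightarrow> real" assume f: "continuous_on UNIV f" "\<And>x. \<bar>f x\<bar> \<le> 1"
  have [measurable]: "f \<in> borel_measurable borel"
    by (rule borel_measurable_continuous_onI[OF f(1)])
  let ?g = "\<lambda>y. (f y + f (- y)) / 2"
  have g: "continuous_on UNIV ?g"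
    by (intro continuous_intros continuous_on_compose2[OF f(1)]) auto
  have g_le: "\<bar>?g y\<bar> \<le> 1" for y using f(2)[of y] f(2)[of "- y"] by (auto simp: abs_le_iff)
  have int: "integrable lborel (\<lambda>x. f (s *\<^sub>R tilt_map \<psi> x) * ?h x)" for s
  proof (rule Bochner_Integration.integrable_bound[OF mass_integrable[of \<psi>]])
    show "AE x in lborel. norm (f (s *\<^sub>R tilt_map \<psi> x) * ?h x) \<le> norm (?h x)"
      using f(2) by (auto simp: abs_mult intro!: mult_left_le_one_le)
  qed measurable
  \<comment> \<open>Reflecting \<open>x\<close> preserves Lebesgue measure and the even density and
    negates the odd map, so \<open>f\<close> may be replaced by its even part on this side
    too.\<close>
  have swap: "(\<integral>x. f (- tilt_map \<psi> x) * ?h x \<partial>lborel) = (\<integral>x. f (tilt_map \<psi> x) * ?h x \<partial>lborel)"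
    using integral_lborel_uminus[of "\<lambda>x. f (tilt_map \<psi> x) * ?h x"]
    by (simp add: h_even tilt_map_uminus[of \<psi>, OF even])
  have "(\<integral>y. f y \<partial>?\<nu>) = (\<integral>x. f (tilt_map \<psi> x) \<partial>?D)"
    by (rule integral_distr) measurable
  also have "\<dots> = (\<integral>x. c * ?h x * f (tilt_map \<psi> x) \<partial>lborel)"
    using h by (subst integral_density) auto
  also have "\<dots> = c * (\<integral>x. f (tilt_map \<psi> x) * ?h x \<partial>lborel)"
    by (simp add: mult.assoc mult.commute[of "f _"] flip: integral_mult_right_zero)
  also have "(\<integral>x. f (tilt_map \<psi> x) * ?h x \<partial>lborel)
      = (\<integral>x. (f (tilt_map \<psi> x) * ?h x + f (- tilt_map \<psi> x) * ?h x) / 2 \<partial>lborel)"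
    using int[of 1] int[of "-1"] swap by simp
  also have "\<dots> = (\<integral>x. ?g (tilt_map \<psi> x) * ?h x \<partial>lborel)"
    by (simp add: algebra_simps)
  also have "\<dots> = mass \<psi> * average ?g"
    by (rule euler_lagrange[OF \<psi> max g g_le]) (auto simp: add.commute)
  also have "c * \<dots> = (\<integral>y. ?g y \<partial>\<mu>)"
    using pos measure_target_pos by (simp add: c_def average_def)
  also have "\<dots> = (\<integral>y. f y \<partial>\<mu>)"
    by (rule integral_even_part_target[OF f])
  finally show "(\<integral>y. f y \<partial>?\<nu>) = (\<integral>y. f y \<partial>\<mu>)" .
qed

end

section \<open>The solution\<close>

text \<open>The potential is a supremum of affine functions of \<open>x\<close>, hence convex and
  lower semicontinuous for every \<open>\<psi>\<close>.\<close>

lemma LC_scaled_expconj: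
  fixes \<psi> :: "'a::euclidean_space \<Rightarrow> real"
  assumes c: "c > 0"
  shows "(\<lambda>x. c * expconj UNIV \<psi> x) \<in> LC"
proof -
  define a where "a y x = x \<bullet> y - \<psi> y - ln c" for y x :: 'a
  define \<phi> where "\<phi> x = (SUP y. ereal (a y x))" for x
  have le: "ereal (a y x) \<le> \<phi> x" for x y
    unfolding \<phi>_def by (rule SUP_upper) simp
  have "\<phi> x \<noteq> - \<infinity>" for x
    using le[of 0 x] by auto
  moreover have "lower_semicontinuous \<phi>"
    unfolding lower_semicontinuous_def
  proof
    fix x
    have "ereal (a y x) \<le> Liminf (at x) \<phi>" for y
    proof -
      have "((\<lambda>z. ereal (a y z)) \<longlongrightarrow> ereal (a y x)) (at x)"
        unfolding a_def by (intro tendsto_intros)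
      then have "ereal (a y x) = Liminf (at x) (\<lambda>z. ereal (a y z))"
        by (intro lim_imp_Liminf[symmetric]) auto
      also have "\<dots> \<le> Liminf (at x) \<phi>"
        by (intro Liminf_mono always_eventually allI le)
      finally show ?thesis .
    qed
    then show "\<phi> x \<le> Liminf (at x) \<phi>"
      unfolding \<phi>_def[of x] by (intro SUP_least)
  qed
  moreover have "ereal_convex \<phi>"
    unfolding ereal_convex_def
  proof (intro allI impI)
    fix x y :: 'a and t :: real assume t: "0 < t \<and> t < 1"
    show "\<phi> ((1 - t) *\<^sub>R x + t *\<^sub>R y) \<le> ereal (1 - t) * \<phi> x + ereal t * \<phi> y"
      unfolding \<phi>_def[of "(1 - t) *\<^sub>R x + t *\<^sub>R y"]
    proof (rule SUP_least)
      fix z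
      have "ereal (a z ((1 - t) *\<^sub>R x + t *\<^sub>R y)) = ereal (1 - t) * ereal (a z x) + ereal t * ereal (a z y)"
        by (simp add: a_def inner_add_left algebra_simps)
      also have "\<dots> \<le> ereal (1 - t) * \<phi> x + ereal t * \<phi> y"
        using t by (intro add_mono ereal_mult_left_mono le) auto
      finally show "ereal (a z ((1 - t) *\<^sub>R x + t *\<^sub>R y)) \<le> ereal (1 - t) * \<phi> x + ereal t * \<phi> y" .
    qed
  qed
  moreover have "c * expconj UNIV \<psi> x = exp_minus (\<phi> x)" for x
  proof -
    have exp_a: "c * exp (\<psi> y - x \<bullet> y) = exp (- a y x)" for y
    proof -
      have "exp (- a y x) = exp (ln c + (\<psi> y - x \<bullet> y))" by (simp add: a_def)
      then show ?thesis using c by (simp only: exp_add exp_ln)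
    qed
    have ge: "exp (- r) \<le> c * expconj UNIV \<psi> x" if "\<phi> x \<le> ereal r" for r
    proof -
      have "exp (- r) / c \<le> expconj UNIV \<psi> x"
      proof (rule expconj_greatest)
        fix y
        have "a y x \<le> r" using order_trans[OF le[of y x] that] by simp
        then have "exp (- r) \<le> c * exp (\<psi> y - x \<bullet> y)" by (simp add: exp_a)
        then show "exp (- r) / c \<le> exp (\<psi> y - x \<bullet> y)"
          using c by (simp add: divide_le_eq mult.commute)
      qed simp
      then show ?thesis using c by (simp add: divide_le_eq mult.commute)
    qed
    have upper: "\<phi> x \<le> ereal (- ln (c * expconj UNIV \<psi> x))" if "expconj UNIV \<psi> x > 0"
      unfolding \<phi>_def
    proof (rule SUP_least)
      fix y
      have "c * expconj UNIV \<psi> x \<le> exp (- a y x)"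
        unfolding exp_a[symmetric] using c by (intro mult_left_mono expconj_le) auto
      then have "ln (c * expconj UNIV \<psi> x) \<le> ln (exp (- a y x))"
        using that c by (subst ln_le_cancel_iff) auto
      then show "ereal (a y x) \<le> ereal (- ln (c * expconj UNIV \<psi> x))" by simp
    qed
    show ?thesis
    proof (cases "\<phi> x")
      case (real r)
      have "exp (- r) \<le> c * expconj UNIV \<psi> x" using ge[of r] real by simp
      moreover from this have pos: "expconj UNIV \<psi> x > 0"
        using c exp_gt_zero[of "- r"] by (metis less_le_trans zero_less_mult_pos)
      have "c * expconj UNIV \<psi> x \<le> exp (- r)"
      proof -
        have "ln (c * expconj UNIV \<psi> x) \<le> - r" using upper[OF pos] real by simp
        then have "exp (ln (c * expconj UNIV \<psi> x)) \<le> exp (- r)" by simp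
        then show ?thesis using pos c by simp
      qed
      ultimately show ?thesis using real by (simp add: exp_minus_def)
    next
      case PInf
      then have "\<not> expconj UNIV \<psi> x > 0" using upper by auto
      then have "expconj UNIV \<psi> x = 0" using expconj_nonneg[of UNIV \<psi> x] by simp
      then show ?thesis using PInf by (simp add: exp_minus_def)
    next
      case MInf
      then show ?thesis using le[of 0 x] by simp
    qed
  qed
  ultimately show ?thesis unfolding LC_def by blast
qed

lemma has_gradient_unique:
  assumes "has_gradient \<phi> x v" "has_gradient \<phi> x w"
  shows "v = w"
proof -
  have "(\<lambda>h. h \<bullet> v) = (\<lambda>h. h \<bullet> w)"
    using assms unfolding has_gradient_def gderiv_def by (intro has_derivative_unique) auto
  then have "(v - w) \<bullet> v = (v - w) \<bullet> w" by meson
  then have "(v - w) \<bullet> (v - w) = 0" by (simp add: inner_diff_right)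
  then show ?thesis by simp
qed

text \<open>Up to a null set, the gradient condition and the preimage of \<open>B\<close> under
  \<open>tilt_map \<psi>\<close> agree wherever the density is positive. Replacing one by the other
  under the integral leads to a Borel set and a pushforward.\<close>

lemma dual_curvature_scaled_expconj:
  fixes \<psi> :: "'a::euclidean_space \<Rightarrow> real"
  assumes cont: "continuous_on UNIV \<psi>" and c: "c > 0" and B: "B \<in> sets borel"
  shows "dual_curvature q (\<lambda>x. c * expconj UNIV \<psi> x) B =
    emeasure (distr (density lborel (\<lambda>x. ennreal (norm x powr (q - DIM('a)) * (c * expconj UNIV \<psi> x))))
      borel (tilt_map \<psi>)) B"
proof -
  let ?f = "\<lambda>x. c * expconj UNIV \<psi> x"
  let ?w = "\<lambda>x::'a. ennreal (norm x powr (q - DIM('a)) * ?f x)"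
  note [measurable] = borel_measurable_tilt_map[OF cont] B
  have [measurable]: "expconj UNIV \<psi> \<in> borel_measurable borel"
    by (rule borel_measurable_expconj) simp
  have "AE x in lborel. ?w x * indicator {x. \<exists>v\<in>B. has_gradient (potential ?f) x v} x
      = ?w x * indicator (tilt_map \<psi> -` B) x"
    using AE_unique_argmin[OF cont]
  proof eventually_elim
    case (elim x)
    show ?case
    proof (cases "expconj UNIV \<psi> x > 0")
      case True
      with elim have "has_gradient (potential ?f) x (tilt_map \<psi> x)"
        by (intro has_gradient_potential_expconj[OF cont _ c]) simp
      then have "(\<exists>v\<in>B. has_gradient (potential ?f) x v) \<longleftrightarrow> tilt_map \<psi> x \<in> B"
        using has_gradient_unique by blast
      then show ?thesis by (simp add: indicator_def)
    next
      case False
      then have "expconj UNIV \<psi> x = 0" using expconj_nonneg[of UNIV \<psi> x] by simp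
      then show ?thesis by simp
    qed
  qed
  then have "dual_curvature q ?f B = (\<integral>\<^sup>+ x. ?w x * indicator (tilt_map \<psi> -` B) x \<partial>lborel)"
    unfolding dual_curvature_def by (rule nn_integral_cong_AE)
  also have "\<dots> = emeasure (density lborel ?w) (tilt_map \<psi> -` B)"
    using measurable_sets_borel[OF borel_measurable_tilt_map[OF cont] B]
    by (subst emeasure_density) auto
  also have "\<dots> = emeasure (distr (density lborel ?w) borel (tilt_map \<psi>)) B"
    using B by (subst emeasure_distr) auto
  finally show ?thesis .
qed

theorem theorem1p4:
  fixes q :: real and \<mu> :: "(real ^ 'n) measure"
  assumes "q > 0"
    and "sets \<mu> = sets borel"
    and "finite_measure \<mu>"
    and "emeasure \<mu> UNIV \<noteq> 0"
    and "even_measure \<mu>"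
    and "not_concentrated_in_proper_subspace \<mu>"
    and "(\<integral>\<^sup>+ x. ennreal (norm x) \<partial>\<mu>) < \<infinity>"
  shows "\<exists>f\<^sub>0 :: real ^ 'n \<Rightarrow> real.
           f\<^sub>0 \<in> LC \<and> (\<forall>x. f\<^sub>0 (- x) = f\<^sub>0 x) \<and>
           integrable lborel f\<^sub>0 \<and> (\<integral>x. norm (f\<^sub>0 x) \<partial>lborel) \<noteq> 0 \<and>
           (\<forall>B\<in>sets borel. emeasure \<mu> B = dual_curvature q f\<^sub>0 B)"
proof -
  define n :: real where "n = DIM(real ^ 'n)"
  \<comment> \<open>The cutoff makes the weight integrable and loses nothing, since
    \<open>expconj UNIV \<psi>\<close> vanishes outside the unit ball for admissible
    \<open>\<psi>\<close>.\<close>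
  define \<omega> :: "real ^ 'n \<Rightarrow> real" where "\<omega> x = norm x powr (q - n) * indicator (cball 0 1) x" for x
  have \<omega>_nonneg: "0 \<le> \<omega> x" for x by (simp add: \<omega>_def)
  have \<omega>_nn: "(\<integral>\<^sup>+ x. ennreal (\<omega> x) \<partial>lborel) < \<infinity>"
  proof -
    have "ennreal (\<omega> x) = ennreal (norm x powr (q - n)) * indicator (cball 0 1) x" for x
      by (simp add: \<omega>_def indicator_def)
    then show ?thesis
      using nn_integral_norm_powr_unit_ball[where 'a = "real ^ 'n", OF \<open>q > 0\<close>] by (simp add: n_def)
  qed
  have \<omega>_meas: "\<omega> \<in> borel_measurable borel" 
    unfolding \<omega>_def by (intro borel_measurable_times borel_measurable_indicator) simp_all
  have \<omega>_int: "integrable lborel \<omega>"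
    using \<omega>_nn \<omega>_meas by (intro integrableI_nonneg) (auto simp: \<omega>_def)
  have \<omega>_pos: "0 < (\<integral>x. \<omega> x \<partial>lborel)"
  proof -
    have "(\<integral>x. \<omega> x \<partial>lborel) \<noteq> 0"
    proof
      assume "(\<integral>x. \<omega> x \<partial>lborel) = 0"
      then have "AE x in lborel. \<omega> x = 0"
        using integral_nonneg_eq_0_iff_AE[OF \<omega>_int] \<omega>_nonneg by simp
      \<comment> \<open>The weight is positive on the open ball except at the origin, where
        \<open>0 powr _\<close> is 0; removing that null point makes the ball itself null, a
        contradiction.\<close>
      with AE_lborel_singleton[of 0] have "AE x in lborel. x \<notin> ball (0 :: real ^ 'n) 1"
        by eventually_elim (auto simp: \<omega>_def indicator_def split: if_splits)
      then have "emeasure lborel (ball (0 :: real ^ 'n) 1) = 0"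
        by (subst (asm) AE_iff_null_sets[symmetric]) auto
      then show False
        using unit_ball_vol_pos[of "DIM(real ^ 'n)"]
        by (simp add: emeasure_ball ennreal_eq_0_iff not_le[symmetric] del: unit_ball_vol_pos)
    qed
    moreover have "(\<integral>x. \<omega> x \<partial>lborel) \<ge> 0" by (simp add: \<omega>_nonneg)
    ultimately show ?thesis by linarith
  qed
  interpret weighted_moment_problem \<omega> \<mu>
  proof (rule weighted_moment_problem.intro)
    show "\<omega> (- x) = \<omega> x" for x by (simp add: \<omega>_def indicator_def)
    show "\<omega> x = 0" if "norm x > 1" for x using that by (simp add: \<omega>_def)
    have "norm \<in> borel_measurable \<mu>"
      unfolding measurable_cong_sets[OF assms(2) refl] by (rule borel_measurable_norm)
    then show "integrable \<mu> norm"
      by (rule integrableI_nonneg) (use assms(7) in simp_all)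
  qed (fact \<omega>_int \<omega>_nonneg \<omega>_pos assms)+
  obtain \<psi> where \<psi>: "admissible \<psi>" "mass \<psi> > 0" "\<And>\<psi>'. admissible \<psi>' \<Longrightarrow> score \<psi>' \<le> score \<psi>"
    using score_maximiser by blast
  define c where "c = measure \<mu> UNIV / mass \<psi>"
  have c: "c > 0" using \<psi>(2) measure_target_pos by (simp add: c_def)
  define f where "f x = c * expconj UNIV \<psi> x" for x
  have zero: "expconj UNIV \<psi> x = 0" if "norm x > 1" for x
    using \<psi>(1) that by (intro expconj_eq_0) (auto simp: admissible_def)
  have f_nonneg: "f x \<ge> 0" for x using c by (simp add: f_def expconj_nonneg)
  have f_meas: "f \<in> borel_measurable borel"
    unfolding f_def by (intro borel_measurable_times borel_measurable_const borel_measurable_expconj) simp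
  have weight: "norm x powr (q - n) * f x = c * (expconj UNIV \<psi> x * \<omega> x)" for x
    using zero[of x] by (cases "norm x \<le> 1") (auto simp: \<omega>_def f_def)
  have curv: "dual_curvature q f B = emeasure \<mu> B" if "B \<in> sets borel" for B
  proof -
    have "dual_curvature q f B =
        emeasure (distr (density lborel (\<lambda>x. ennreal (norm x powr (q - n) * f x))) borel (tilt_map \<psi>)) B"
      unfolding f_def n_def
      by (rule dual_curvature_scaled_expconj[OF admissible_continuous[OF \<psi>(1)] c that])
    also have "\<dots> = emeasure \<mu> B"
      unfolding weight by (simp only: c_def distr_tilt_map_eq_target[OF \<psi>])
    finally show ?thesis .
  qed
  have f_int: "integrable lborel f"
  proof (rule Bochner_Integration.integrable_bound)
    show "integrable lborel (\<lambda>x::real ^ 'n. c * exp (\<psi> 0) * indicator (cball 0 1) x)"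
      by (intro integrable_mult_right integrable_real_indicator) (auto simp: emeasure_cball)
    have "f x \<le> c * exp (\<psi> 0) * indicator (cball 0 1) x" for x
      using zero[of x] expconj_le[of 0 UNIV \<psi> x] c by (cases "norm x \<le> 1") (auto simp: f_def)
    then show "AE x in lborel. norm (f x) \<le> norm (c * exp (\<psi> 0) * indicator (cball 0 1) x)"
      using f_nonneg by (intro AE_I2) (simp add: order_trans[OF _ abs_ge_self])
  qed (use f_meas in simp)
  \<comment> \<open>A vanishing norm would make \<open>expconj UNIV \<psi>\<close> zero almost
    everywhere, against the positive mass of the maximiser.\<close>
  have f_ne: "(\<integral>x. norm (f x) \<partial>lborel) \<noteq> 0"
  proof
    assume "(\<integral>x. norm (f x) \<partial>lborel) = 0"
    then have "AE x in lborel. f x = 0"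
      using integral_nonneg_eq_0_iff_AE[of lborel "\<lambda>x. norm (f x)"] f_int by simp
    then have "AE x in lborel. expconj UNIV \<psi> x * \<omega> x = 0"
      by eventually_elim (use c in \<open>auto simp: f_def\<close>)
    then have "mass \<psi> = 0" unfolding mass_def by (rule integral_eq_zero_AE)
    with \<psi>(2) show False by simp
  qed
  show ?thesis
  proof (intro exI[of _ f] conjI allI ballI)
    show "f \<in> LC" unfolding f_def by (rule LC_scaled_expconj[OF c])
    show "f (- x) = f x" for x
      using \<psi>(1) by (simp add: f_def expconj_uminus admissible_def)
  qed (use f_int f_ne curv in auto)
qed

end
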